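(* Let $d\ge 1$ be an integer. Every injective function $f\colon \mathrm{sk}_d(\Delta_{2d+2})\to\mathbb{R}^{2d}$ (not assumed continuous) satisfies $\alpha(f)\ge r_{2d-1}=\arccos\left(\frac{-1}{2d}\right)$.
   Context: $\mathrm{sk}_d(\Delta_{2d+2})$ is the $d$-skeleton of the $(2d+2)$-dimensional simplex (geometric realization). For a topological space $X$ and a metric space $Y$, the modulus of discontinuity of a function $g\colon X\to Y$ is $\delta(g)=\inf\{\delta\ge 0 : \text{for every } x\in X \text{ there is an open neighborhood } U_x \text{ of } x \text{ with } \operatorname{diam}(g(U_x))\le\delta\}$. The unit sphere $S^{m-1}$ carries the geodesic metric $d(u,v)=\arccos\langle u,v\rangle$. For a topological space $X$, $\mathrm{Conf}_2(X)=\{(x,y)\in X\times X: x\neq y\}$ with the subspace topology. For an injective function $f\colon X\to\mathbb{R}^m$, define $\Phi_f\colon \mathrm{Conf}_2(X)\to S^{m-1}$ by $\Phi_f(x,y)=\frac{f(x)-f(y)}{\|f(x)-f(y)\|}$ and $\alpha(f)=\delta(\Phi_f)$. For $n\ge 0$, $r_n=\arccos\left(\frac{-1}{n+1}\right)$. *)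

theory Defs
  imports "HOL-Analysis.Analysis"
begin

text \<open>Points of the standard simplex with n+1 vertices 0..n are modelled as functions
  nat => real supported in {0..n} (barycentric coordinates).  The d-skeleton consists of
  the points with at most d+1 nonzero coordinates.  The topology is the subspace topology
  of the product topology on nat => real (which on this finite-dimensional set agrees with
  the Euclidean topology).\<close>

definition skeleton :: "nat \<Rightarrow> nat \<Rightarrow> (nat \<Rightarrow> real) set" where
  "skeleton d n = {x. (\<forall>i. 0 \<le> x i) \<and> (\<forall>i>n. x i = 0) \<and> (\<Sum>i\<le>n. x i) = 1
                       \<and> card {i. x i \<noteq> 0} \<le> d + 1}"

definition skeleton_top :: "nat \<Rightarrow> nat \<Rightarrow> (nat \<Rightarrow> real) topology" where
  "skeleton_top d n = subtopology euclidean (skeleton d n)"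

definition Conf2 :: "'a topology \<Rightarrow> ('a \<times> 'a) topology" where
  "Conf2 X = subtopology (prod_topology X X)
              {(x, y). x \<in> topspace X \<and> y \<in> topspace X \<and> x \<noteq> y}"

text \<open>Vectors of R^m are functions nat => real, only coordinates i < m being relevant.\<close>
definition vinner :: "nat \<Rightarrow> (nat \<Rightarrow> real) \<Rightarrow> (nat \<Rightarrow> real) \<Rightarrow> real" where
  "vinner m u v = (\<Sum>i<m. u i * v i)"

definition vnorm :: "nat \<Rightarrow> (nat \<Rightarrow> real) \<Rightarrow> real" where
  "vnorm m u = sqrt (vinner m u u)"

definition geodist :: "nat \<Rightarrow> (nat \<Rightarrow> real) \<Rightarrow> (nat \<Rightarrow> real) \<Rightarrow> real" where
  "geodist m u v = arccos (vinner m u v)"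

definition mdiam :: "('b \<Rightarrow> 'b \<Rightarrow> real) \<Rightarrow> 'b set \<Rightarrow> real" where
  "mdiam \<rho> A = Sup {\<rho> u v | u v. u \<in> A \<and> v \<in> A}"

definition mod_discont :: "'a topology \<Rightarrow> ('b \<Rightarrow> 'b \<Rightarrow> real) \<Rightarrow> ('a \<Rightarrow> 'b) \<Rightarrow> real" where
  "mod_discont X \<rho> g = Inf {\<delta>. \<delta> \<ge> 0 \<and>
      (\<forall>x\<in>topspace X. \<exists>U. openin X U \<and> x \<in> U \<and> mdiam \<rho> (g ` U) \<le> \<delta>)}"

definition Phi :: "nat \<Rightarrow> ('a \<Rightarrow> (nat \<Rightarrow> real)) \<Rightarrow> 'a \<times> 'a \<Rightarrow> (nat \<Rightarrow> real)" where
  "Phi m f = (\<lambda>(x, y). (\<lambda>i. if i < m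
        then (f x i - f y i) / vnorm m (\<lambda>j. f x j - f y j) else 0))"

definition alpha :: "'a topology \<Rightarrow> nat \<Rightarrow> ('a \<Rightarrow> (nat \<Rightarrow> real)) \<Rightarrow> real" where
  "alpha X m f = mod_discont (Conf2 X) (geodist m) (Phi m f)"

definition r_const :: "nat \<Rightarrow> real" where
  "r_const n = arccos (-1 / (real n + 1))"

end

theory Submission
  imports Defs "HOL-Library.Poly_Mapping" "HOL-Library.Z2"
begin

text \<open>Suppose the modulus of discontinuity is smaller than \<open>arccos (- 1 / m)\<close> with \<open>m = 2 d\<close>.
  The deleted product of the skeleton contains mod 2 chains \<open>h 0, \<dots>, h m\<close> with
  \<open>\<partial> h (n + 1) = h n + \<nu> (h n)\<close>, where \<open>\<nu>\<close> swaps the two factors and \<open>h 0\<close> has an odd number of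
  points; this is the van Kampen obstruction in chain form.  After subdivision the direction map
  sends the at most \<open>m + 1\<close> vertices of each simplex to unit vectors whose pairwise inner products
  are at least some \<open>s > - 1 / m\<close>, and the convex hull of such vectors stays away from \<open>0\<close>.  The
  image chains are therefore of the same kind in the complement of the origin of \<open>R^m\<close>, with
  \<open>\<nu> = -\<close>.  Subdividing them again and labelling points by the sign and the index of a largest
  coordinate contradicts Fan's lemma, since \<open>m\<close> labels do not suffice for an alternating
  \<open>m\<close>-simplex.\<close>

section \<open>Chains with coefficients modulo two\<close>

class char_two = comm_monoid_add +
  assumes add_self [simp]: "x + x = 0"
begin

lemma add_self_left [simp]: "x + (x + y) = y"
  by (simp add: add.assoc [symmetric])

end

instance bit :: char_two
proof
  show "x + x = 0" for x :: bit
    by (cases x) simp_all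
qed

instance poly_mapping :: (type, char_two) char_two
  by standard (simp add: poly_mapping_eq_iff fun_eq_iff lookup_add)

declare add_bit_eq_xor [simp del]

type_synonym 'x chain = "'x \<Rightarrow>\<^sub>0 bit"

abbreviation gen :: "'x \<Rightarrow> 'x chain" where
  "gen x \<equiv> Poly_Mapping.single x 1"

text \<open>Linear extension from generators: every nonzero coefficient in \<open>bit\<close> is 1,
  so summing over the support suffices.\<close>

definition lin :: "('x \<Rightarrow> 'b::char_two) \<Rightarrow> 'x chain \<Rightarrow> 'b" where
  "lin f c = sum f (Poly_Mapping.keys c)"

abbreviation chmap :: "('x \<Rightarrow> 'y) \<Rightarrow> 'x chain \<Rightarrow> 'y chain" where
  "chmap h \<equiv> lin (\<lambda>x. gen (h x))"

lemma lin_0 [simp]: "lin f 0 = 0"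
  by (simp add: lin_def)

lemma lin_gen [simp]: "lin f (gen x) = f x"
  by (simp add: lin_def)

lemma lin_eq_sum_superset:
  assumes "finite A" "Poly_Mapping.keys c \<subseteq> A"
  shows "lin f c = (\<Sum>x\<in>A. if Poly_Mapping.lookup c x = 1 then f x else 0)"
proof -
  have "(\<Sum>x\<in>A. if Poly_Mapping.lookup c x = 1 then f x else 0) =
      (\<Sum>x\<in>Poly_Mapping.keys c. if Poly_Mapping.lookup c x = 1 then f x else 0)"
    using assms by (intro sum.mono_neutral_right) (auto simp: in_keys_iff)
  also have "\<dots> = lin f c"
    unfolding lin_def by (rule sum.cong) (auto simp: in_keys_iff)
  finally show ?thesis ..
qed

lemma lin_add [simp]: "lin f (a + b) = lin f a + lin f b"
proof -
  let ?A = "Poly_Mapping.keys a \<union> Poly_Mapping.keys b"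
  have "lin f (a + b) = (\<Sum>x\<in>?A. if Poly_Mapping.lookup (a + b) x = 1 then f x else 0)"
    by (rule lin_eq_sum_superset) (auto simp: keys_add)
  also have "\<dots> = (\<Sum>x\<in>?A. (if Poly_Mapping.lookup a x = 1 then f x else 0) + (if Poly_Mapping.lookup b x = 1 then f x else 0))"
    by (rule sum.cong) (auto simp: lookup_add)
  also have "\<dots> = lin f a + lin f b"
    by (simp add: sum.distrib lin_eq_sum_superset [of ?A a] lin_eq_sum_superset [of ?A b])
  finally show ?thesis .
qed

lemma lin_cong: "(\<And>x. x \<in> Poly_Mapping.keys c \<Longrightarrow> f x = g x) \<Longrightarrow> lin f c = lin g c"
  by (simp add: lin_def)

lemma lin_zero_fun [simp]: "lin (\<lambda>x. 0) c = 0"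
  by (simp add: lin_def)

lemma lin_add_fun: "lin (\<lambda>x. f x + g x) c = lin f c + lin g c"
  by (simp add: lin_def sum.distrib)

lemma lin_sum: "lin f (sum g A) = (\<Sum>x\<in>A. lin f (g x))"
  by (induction A rule: infinite_finite_induct) simp_all

lemma lin_lin: "lin f (lin g c) = lin (\<lambda>x. lin f (g x)) c"
  unfolding lin_def [of g] lin_def [of "\<lambda>x. lin f (g x)"] by (rule lin_sum)

lemma lin_gen_id [simp]: "lin gen c = c"
proof (rule poly_mapping_eqI)
  fix k
  have "Poly_Mapping.lookup (lin gen c) k = (\<Sum>x\<in>Poly_Mapping.keys c. if x = k then 1 else 0)"
    by (simp add: lin_def lookup_sum lookup_single when_def)
  also have "\<dots> = Poly_Mapping.lookup c k"
    by (auto simp: in_keys_iff)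
  finally show "Poly_Mapping.lookup (lin gen c) k = Poly_Mapping.lookup c k" .
qed

lemma keys_linD: "y \<in> Poly_Mapping.keys (lin f c) \<Longrightarrow> \<exists>x\<in>Poly_Mapping.keys c. y \<in> Poly_Mapping.keys (f x)"
  unfolding lin_def using keys_sum [of f "Poly_Mapping.keys c"] by auto

lemma lin_if_const:
  "lin (\<lambda>x. if P x then z else 0) c = (if lin (\<lambda>x. of_bool (P x)) c = (1::bit) then z else 0)"
proof -
  have "(\<Sum>x\<in>A. if P x then z else 0) = (if (\<Sum>x\<in>A. of_bool (P x)) = (1::bit) then z else 0)"
    if "finite A" for A
    using that by (induction A rule: finite_induct) auto
  then show ?thesis
    by (simp add: lin_def)
qed

definition cone_on :: "'x \<Rightarrow> 'x list chain \<Rightarrow> 'x list chain" where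
  "cone_on x c = chmap (Cons x) c"

lemma cone_simps [simp]:
  "cone_on x 0 = 0" "cone_on x (gen t) = gen (x # t)" "cone_on x (a + b) = cone_on x a + cone_on x b"
  by (simp_all add: cone_on_def)

lemma lin_cone: "lin f (cone_on x c) = lin (\<lambda>t. f (x # t)) c"
  by (simp add: cone_on_def lin_lin)

lemma keys_coneD: "s \<in> Poly_Mapping.keys (cone_on x c) \<Longrightarrow> \<exists>t\<in>Poly_Mapping.keys c. s = x # t"
  unfolding cone_on_def by (drule keys_linD) auto

text \<open>The boundary is augmented: a one-element list has boundary \<open>gen []\<close>.\<close>

primrec bdry :: "'x list \<Rightarrow> 'x list chain" where
  "bdry [] = 0"
| "bdry (x # t) = gen t + cone_on x (bdry t)"

text \<open>The cone formula, without exception in dimension 0 thanks to the augmentation. For a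
  cycle \<open>c\<close> it provides a filling, on which every subdivision below rests.\<close>

lemma lin_bdry_cone: "lin bdry (cone_on x c) = c + cone_on x (lin bdry c)"
proof -
  have "lin bdry (cone_on x c) = lin gen c + lin (\<lambda>t. cone_on x (bdry t)) c"
    by (simp only: lin_cone bdry.simps lin_add_fun)
  then show ?thesis
    by (simp add: cone_on_def lin_lin)
qed

lemma bdry_bdry: "lin bdry (bdry t) = 0"
  by (induction t) (simp_all add: lin_bdry_cone)

lemma keys_bdryD:
  "s \<in> Poly_Mapping.keys (bdry t) \<Longrightarrow> Suc (length s) = length t \<and> set s \<subseteq> set t"
proof (induction t arbitrary: s)
  case (Cons x t)
  then have "s = t \<or> s \<in> Poly_Mapping.keys (cone_on x (bdry t))"
    using keys_add [of "gen t" "cone_on x (bdry t)"] by auto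
  then show ?case
    using Cons.IH by (fastforce dest: keys_coneD)
qed simp

lemma chmap_cone: "chmap (map f) (cone_on x c) = cone_on (f x) (chmap (map f) c)"
  by (simp add: cone_on_def lin_lin)

lemma bdry_map: "bdry (map f t) = chmap (map f) (bdry t)"
  by (induction t) (simp_all add: chmap_cone)

lemma lin_bdry_chmap: "lin bdry (chmap (map f) c) = chmap (map f) (lin bdry c)"
  by (simp add: lin_lin bdry_map)

text \<open>A tower of height \<open>k\<close> is the chain-level shadow of an equivariant map from the
  \<open>k\<close>-sphere: \<open>h n\<close> plays the role of a closed hemisphere of dimension \<open>n\<close>.\<close>

definition tower :: "nat \<Rightarrow> ('x \<Rightarrow> 'x) \<Rightarrow> (nat \<Rightarrow> 'x list chain) \<Rightarrow> bool" where
  "tower k \<nu> h \<longleftrightarrow>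
     (\<forall>n\<le>k. \<forall>t\<in>Poly_Mapping.keys (h n). length t = Suc n) \<and>
     lin (\<lambda>_. 1 :: bit) (h 0) = 1 \<and>
     (\<forall>n<k. lin bdry (h (Suc n)) = h n + chmap (map \<nu>) (h n))"

text \<open>Only values on vertices enter, so no continuity of \<phi> is required; this is how the
  direction map is applied.\<close>

lemma tower_map:
  assumes "tower k \<nu> h" and "\<And>x. \<phi> (\<nu> x) = \<mu> (\<phi> x)"
  shows "tower k \<mu> (\<lambda>n. chmap (map \<phi>) (h n))"
proof -
  have "\<phi> \<circ> \<nu> = \<mu> \<circ> \<phi>"
    using assms(2) by auto
  then show ?thesis
    using assms(1) unfolding tower_def lin_bdry_chmap
    by (auto dest!: keys_linD simp: lin_lin)
qed

section \<open>Fan's parity argument\<close>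

text \<open>The coboundary identity for \<open>alt\<close> holds for arbitrary sign patterns.  The absence of
  complementary labels only matters after sorting by index, where it forces the indices of an
  alternating simplex to be distinct.\<close>

primrec alt :: "('x \<Rightarrow> bool) \<Rightarrow> bool \<Rightarrow> 'x list \<Rightarrow> bit" where
  "alt p b [] = 1"
| "alt p b (x # t) = (if p x = b then alt p (\<not> b) t else 0)"

text \<open>An alternating list has alternating faces only where its first or last entry is dropped.
  Any other list has them in pairs with the same signs, from dropping either entry of its single
  repeated sign.\<close>

lemma lin_alt_bdry: "lin (alt p b) (bdry t) = alt p b t + alt p (\<not> b) t"
proof (induction t arbitrary: b)
  case (Cons x t)
  have "lin (alt p b) (bdry (x # t)) =
      alt p b t + (if p x = b then lin (alt p (\<not> b)) (bdry t) else 0)"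
    by (cases "p x = b") (simp_all add: lin_cone)
  then show ?case
    by (cases "p x = b") (simp_all add: Cons.IH add_ac)
qed simp

lemma bdry_insort_key:
  "sorted (map k s) \<Longrightarrow> bdry (insort_key k x s) = gen s + chmap (insort_key k x) (bdry s)"
proof (induction s)
  case (Cons y s)
  have sorted: "sorted (map k s)" and le: "\<forall>z\<in>set s. k y \<le> k z"
    using Cons.prems by auto
  show ?case
  proof (cases "k x \<le> k y")
    case True
    then have "insort_key k x s = x # s"
      using le by (intro insort_is_Cons) force
    with True show ?thesis
      by (simp add: cone_on_def lin_lin)
  next
    case False
    then show ?thesis
      by (simp add: Cons.IH [OF sorted] cone_on_def lin_lin add_ac)
  qed
qed simp

text \<open>Modulo two a reordering costs no sign, so sorting is a chain map and alternation can be
  tested in the order of the indices.\<close>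

lemma bdry_sort_key: "bdry (sort_key k t) = chmap (sort_key k) (bdry t)"
  by (induction t) (simp_all add: bdry_insort_key cone_on_def lin_lin)

lemma sort_key_map_invariant:
  assumes "\<And>x. k (\<mu> x) = k x"
  shows "sort_key k (map \<mu> t) = map \<mu> (sort_key k t)"
proof (induction t)
  case (Cons x t)
  have "insort_key k (\<mu> x) (map \<mu> s) = map \<mu> (insort_key k x s)" for s
    by (induction s) (simp_all add: assms)
  then show ?case
    by (simp add: Cons.IH)
qed simp

lemma alt_map_odd:
  "(\<And>x. x \<in> set t \<Longrightarrow> p (\<mu> x) \<longleftrightarrow> \<not> p x) \<Longrightarrow> alt p b (map \<mu> t) = alt p (\<not> b) t"
  by (induction t arbitrary: b) auto

text \<open>In sorted order a repeated key would occur at neighbours; these alternate in sign, while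
  equal keys force equal signs.\<close>

lemma alt_imp_distinct:
  assumes "alt p b s \<noteq> 0" "sorted (map k s)"
    and "\<And>x y. x \<in> set s \<Longrightarrow> y \<in> set s \<Longrightarrow> k x = k y \<Longrightarrow> p x = p y"
  shows "distinct (map k s)"
  using assms
proof (induction s arbitrary: b)
  case (Cons x s)
  have px: "p x = b" and alt: "alt p (\<not> b) s \<noteq> 0"
    using Cons.prems(1) by (auto split: if_splits)
  have dist: "distinct (map k s)"
    using Cons.IH [OF alt] Cons.prems(2,3) by auto
  have "k x \<noteq> k z" if "z \<in> set s" for z
  proof (cases s)
    case Nil
    with that show ?thesis by simp
  next
    case (Cons y s')
    then have "p y \<noteq> p x"
      using alt px by (auto split: if_splits)
    then have "k x \<noteq> k y"
      using Cons.prems(3) [of x y] Cons by auto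
    moreover have "k x \<le> k y" "k y \<le> k z"
      using Cons.prems(2) Cons that by auto
    ultimately show ?thesis by simp
  qed
  then show ?case
    using dist by auto
qed simp

text \<open>\<open>B n\<close> is the parity of the number of simplices of \<open>h n\<close> that
  alternate after sorting, with either first sign. It is 1 for \<open>n = 0\<close> and does not
  change with \<open>n\<close>, so \<open>h k\<close> contains an alternating simplex; its
  \<open>k + 1\<close> indices are distinct, yet all lie below \<open>k\<close>.\<close>

theorem Fan_no_tower:
  fixes idx :: "'x \<Rightarrow> nat"
  assumes tower: "tower k \<mu> h"
    and odd: "\<And>n t x. n \<le> k \<Longrightarrow> t \<in> Poly_Mapping.keys (h n) \<Longrightarrow> x \<in> set t \<Longrightarrow> p (\<mu> x) \<longleftrightarrow> \<not> p x"
    and even: "\<And>x. idx (\<mu> x) = idx x"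
    and idx: "\<And>t x. t \<in> Poly_Mapping.keys (h k) \<Longrightarrow> x \<in> set t \<Longrightarrow> idx x < k"
    and nocompl: "\<And>t x y. t \<in> Poly_Mapping.keys (h k) \<Longrightarrow> x \<in> set t \<Longrightarrow> y \<in> set t \<Longrightarrow>
        idx x = idx y \<Longrightarrow> p x = p y"
  shows False
proof -
  define A where "A b t = alt p b (sort_key idx t)" for b t
  define B where "B n = lin (A True) (h n) + lin (A False) (h n)" for n
  have A_bdry: "lin (A True) (bdry t) = A True t + A False t" for t
  proof -
    have "lin (A True) (bdry t) = lin (alt p True) (bdry (sort_key idx t))"
      by (simp add: A_def [abs_def] bdry_sort_key lin_lin)
    then show ?thesis
      by (simp add: lin_alt_bdry A_def)
  qed
  have "B n = 1" if "n \<le> k" for n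
    using that
  proof (induction n)
    case 0
    have "B 0 = lin (\<lambda>_. 1) (h 0)"
      unfolding B_def lin_add_fun [symmetric]
    proof (rule lin_cong)
      fix t assume "t \<in> Poly_Mapping.keys (h 0)"
      then have "length t = 1"
        using tower by (auto simp: tower_def)
      then show "A True t + A False t = 1"
        by (auto simp: A_def length_Suc_conv)
    qed
    then show ?case
      using tower by (simp add: tower_def)
  next
    case (Suc n)
    \<comment> \<open>The coboundary identity read backwards trades both first signs on
      \<open>h (Suc n)\<close> for one first sign on its boundary.\<close>
    have "B (Suc n) = lin (A True) (lin bdry (h (Suc n)))"
      by (simp add: B_def lin_lin A_bdry lin_add_fun)
    also have "\<dots> = lin (A True) (h n) + lin (\<lambda>t. A True (map \<mu> t)) (h n)"
      using tower Suc.prems by (simp add: tower_def lin_lin)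
    \<comment> \<open>The antipodal copy has the opposite first sign and so supplies the other half
      of \<open>B n\<close>.\<close>
    also have "lin (\<lambda>t. A True (map \<mu> t)) (h n) = lin (A False) (h n)"
    proof (rule lin_cong)
      fix t assume "t \<in> Poly_Mapping.keys (h n)"
      then have "alt p True (map \<mu> (sort_key idx t)) = alt p False (sort_key idx t)"
        using odd [of n t] Suc.prems by (subst alt_map_odd) simp_all
      then show "A True (map \<mu> t) = A False t"
        by (simp add: A_def sort_key_map_invariant even)
    qed
    finally show ?case
      using Suc by (simp add: B_def)
  qed
  then have "B k = 1" by simp
  moreover have "A b t = 0" if t: "t \<in> Poly_Mapping.keys (h k)" for b t
  proof (rule ccontr)
    assume "A b t \<noteq> 0"
    then have "distinct (map idx (sort_key idx t))"
      unfolding A_def by (rule alt_imp_distinct) (simp, rule nocompl [OF t], simp_all)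
    then have "card (idx ` set t) = length t"
      using distinct_card by fastforce
    moreover have "card (idx ` set t) \<le> card {..<k}"
      by (rule card_mono) (use idx [OF t] in auto)
    ultimately show False
      using tower t by (auto simp: tower_def)
  qed
  then have "B k = 0"
    unfolding B_def lin_def by (simp add: sum.neutral)
  ultimately show False by simp
qed

section \<open>Subdivision by iterated cones\<close>

text \<open>Cells are encoded by lists; \<open>g\<close> selects those lists that really are cells and
  \<open>b\<close> returns the apex of the cone that replaces a cell.\<close>

primrec csub :: "('x list \<Rightarrow> bool) \<Rightarrow> ('x list \<Rightarrow> 'y) \<Rightarrow> nat \<Rightarrow> 'x list \<Rightarrow> 'y list chain" where
  "csub g b 0 t = (if g t then gen [b t] else 0)"
| "csub g b (Suc n) t = (if g t then cone_on (b t) (lin (csub g b n) (bdry t)) else 0)"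

text \<open>By induction the subdivided boundary is a cycle, hence the boundary of its cone.
  \<open>even\<close> starts the induction: a one-dimensional list has an even number of endpoints.
  The offset \<open>r\<close> is the number of entries of a zero-dimensional cell.\<close>

lemma lin_bdry_csub:
  assumes up: "\<And>s t. s \<in> Poly_Mapping.keys (bdry t) \<Longrightarrow> g s \<Longrightarrow> g t"
    and even: "\<And>t. length t = Suc r \<Longrightarrow> lin (\<lambda>s. of_bool (g s)) (bdry t) = (0::bit)"
  shows "length t = Suc n + r \<Longrightarrow> lin bdry (csub g b (Suc n) t) = lin (csub g b n) (bdry t)"
proof (induction n arbitrary: t)
  case 0
  have "lin bdry (lin (csub g b 0) (bdry t)) = lin (\<lambda>s. if g s then gen [] else 0) (bdry t)"
    unfolding lin_lin by (rule lin_cong) simp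
  also have "\<dots> = 0"
    using even [of t] 0 by (simp add: lin_if_const)
  finally have cyc: "lin bdry (lin (csub g b 0) (bdry t)) = 0" .
  show ?case
  proof (cases "g t")
    case True
    then show ?thesis
      using cyc by (simp add: lin_bdry_cone del: csub.simps(1))
  next
    \<comment> \<open>By \<open>up\<close> no face of a list outside \<open>g\<close> satisfies
      \<open>g\<close>, so both sides vanish.\<close>
    case False
    then have "lin (csub g b 0) (bdry t) = lin (\<lambda>_. 0) (bdry t)"
      using up by (intro lin_cong) auto
    with False show ?thesis by (simp del: csub.simps(1))
  qed
next
  case (Suc n)
  have "lin bdry (lin (csub g b (Suc n)) (bdry t)) = lin (\<lambda>s. lin (csub g b n) (bdry s)) (bdry t)"
    unfolding lin_lin
  proof (rule lin_cong)
    fix s assume "s \<in> Poly_Mapping.keys (bdry t)"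
    then show "lin bdry (csub g b (Suc n) s) = lin (csub g b n) (bdry s)"
      using Suc.IH [of s] Suc.prems keys_bdryD [of s t] by simp
  qed
  also have "\<dots> = 0"
    by (simp add: lin_lin [symmetric] bdry_bdry)
  finally have cyc: "lin bdry (lin (csub g b (Suc n)) (bdry t)) = 0" .
  show ?case
  proof (cases "g t")
    case True
    then show ?thesis
      using cyc by (simp only: csub.simps(2) [of g b "Suc n"] if_True lin_bdry_cone cone_simps add_0_right)
  next
    case False
    then have "lin (csub g b (Suc n)) (bdry t) = lin (\<lambda>_. 0) (bdry t)"
      using up by (intro lin_cong) auto
    with False show ?thesis by (simp only: csub.simps(2) [of g b "Suc n"] if_False lin_0 lin_zero_fun)
  qed
qed

lemma csub_map:
  assumes "\<And>t. g (map \<nu> t) = g t" "\<And>t. b (map \<nu> t) = \<mu> (b t)"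
  shows "csub g b n (map \<nu> t) = chmap (map \<mu>) (csub g b n t)"
proof (induction n arbitrary: t)
  case 0
  show ?case by (simp add: assms)
next
  case (Suc n)
  have "lin (csub g b n) (bdry (map \<nu> t)) = chmap (map \<mu>) (lin (csub g b n) (bdry t))"
    by (simp add: bdry_map lin_lin Suc)
  then show ?case
    by (simp add: assms chmap_cone)
qed

lemma keys_csubD:
  assumes "s \<in> Poly_Mapping.keys (csub g b n t)"
  shows "length s = Suc n \<and> (\<forall>x\<in>set s. \<exists>t'. g t' \<and> set t' \<subseteq> set t \<and> x = b t')"
  using assms
proof (induction n arbitrary: s t)
  case 0
  then show ?case
    by (auto split: if_splits)
next
  case (Suc n)
  then have g: "g t" and "s \<in> Poly_Mapping.keys (cone_on (b t) (lin (csub g b n) (bdry t)))"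
    by (auto split: if_splits)
  then obtain s' t' where s: "s = b t # s'" and t': "t' \<in> Poly_Mapping.keys (bdry t)"
    and s': "s' \<in> Poly_Mapping.keys (csub g b n t')"
    by (blast dest: keys_coneD keys_linD)
  have "set t' \<subseteq> set t"
    using t' keys_bdryD by blast
  then show ?case
    using Suc.IH [OF s'] s g by fastforce
qed

text \<open>Used twice: \<open>r = 1\<close> subdivides simplices, and \<open>r = 2\<close> turns
  product cells into simplices.\<close>

lemma csub_tower:
  assumes up: "\<And>s t. s \<in> Poly_Mapping.keys (bdry t) \<Longrightarrow> g s \<Longrightarrow> g t"
    and even: "\<And>t. length t = Suc r \<Longrightarrow> lin (\<lambda>s. of_bool (g s)) (bdry t) = (0::bit)"
    and len: "\<And>n t. n \<le> k \<Longrightarrow> t \<in> Poly_Mapping.keys (e n) \<Longrightarrow> length t = n + r"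
    and bd: "\<And>n. n < k \<Longrightarrow> lin bdry (e (Suc n)) = e n + chmap (map \<nu>) (e n)"
    and aug: "lin (\<lambda>t. of_bool (g t)) (e 0) = (1::bit)"
    and equivariant: "\<And>t. g (map \<nu> t) = g t" "\<And>t. b (map \<nu> t) = \<mu> (b t)"
  shows "tower k \<mu> (\<lambda>n. lin (csub g b n) (e n))"
  unfolding tower_def
proof (intro conjI allI impI ballI)
  show "length s = Suc n" if "s \<in> Poly_Mapping.keys (lin (csub g b n) (e n))" for n s
    using that by (blast dest: keys_linD keys_csubD)
  have "lin (\<lambda>_. 1 :: bit) (lin (csub g b 0) (e 0)) = lin (\<lambda>t. of_bool (g t)) (e 0)"
    unfolding lin_lin by (rule lin_cong) simp
  then show "lin (\<lambda>_. 1 :: bit) (lin (csub g b 0) (e 0)) = 1"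
    by (simp only: aug)
next
  fix n assume n: "n < k"
  have "lin bdry (lin (csub g b (Suc n)) (e (Suc n))) = lin (\<lambda>t. lin (csub g b n) (bdry t)) (e (Suc n))"
    unfolding lin_lin
    by (rule lin_cong) (use n len [of "Suc n"] in \<open>simp add: lin_bdry_csub [where r = r, OF up even] del: csub.simps\<close>)
  also have "\<dots> = lin (csub g b n) (e n) + lin (\<lambda>t. csub g b n (map \<nu> t)) (e n)"
    by (simp add: lin_lin [symmetric] bd n) (simp add: lin_lin)
  also have "lin (\<lambda>t. csub g b n (map \<nu> t)) (e n) = chmap (map \<mu>) (lin (csub g b n) (e n))"
    by (simp only: csub_map [where g = g and b = b, OF equivariant] lin_lin)
  finally show "lin bdry (lin (csub g b (Suc n)) (e (Suc n))) =
      lin (csub g b n) (e n) + chmap (map \<mu>) (lin (csub g b n) (e n))" .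
qed

section \<open>Barycentric subdivision and its mesh\<close>

definition bary :: "('k \<Rightarrow> real) list \<Rightarrow> 'k \<Rightarrow> real" where
  "bary t = (\<lambda>i. (\<Sum>x\<leftarrow>t. x i) / real (length t))"

text \<open>The part of convexity that iterated subdivision uses; coordinate intervals, cells and
  convex hulls all have it.\<close>

definition bary_closed :: "('k \<Rightarrow> real) set \<Rightarrow> bool" where
  "bary_closed C \<longleftrightarrow> (\<forall>t. t \<noteq> [] \<longrightarrow> set t \<subseteq> C \<longrightarrow> bary t \<in> C)"

text \<open>The empty list only records the augmentation, so it must not become a cell.\<close>

definition sd :: "nat \<Rightarrow> ('k \<Rightarrow> real) list \<Rightarrow> ('k \<Rightarrow> real) list chain" where
  "sd = csub (\<lambda>t. t \<noteq> []) bary"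

lemma sd_tower:
  assumes "tower k \<nu> h" and "\<And>t. bary (map \<nu> t) = \<nu> (bary t)"
  shows "tower k \<nu> (\<lambda>n. lin (sd n) (h n))"
  unfolding sd_def
proof (rule csub_tower [where r = 1])
  show "lin (\<lambda>s. of_bool (s \<noteq> [])) (bdry t) = (0::bit)" if len: "length t = Suc 1" for t :: "('a \<Rightarrow> real) list"
  proof -
    obtain x y where "t = [x, y]"
      using len by (auto simp: length_Suc_conv)
    then show ?thesis by simp
  qed
  have "lin (\<lambda>t. of_bool (t \<noteq> [])) (h 0) = lin (\<lambda>_. 1 :: bit) (h 0)"
    using assms(1) by (intro lin_cong) (force simp: tower_def)
  then show "lin (\<lambda>t. of_bool (t \<noteq> [])) (h 0) = (1::bit)"
    using assms(1) by (simp add: tower_def)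
qed (use assms in \<open>auto simp: tower_def\<close>)

lemma keys_sd_subset:
  assumes "s \<in> Poly_Mapping.keys (sd n t)" "bary_closed C" "set t \<subseteq> C"
  shows "set s \<subseteq> C"
  using assms keys_csubD [of s "\<lambda>t. t \<noteq> []" bary n t]
  by (fastforce simp: sd_def bary_closed_def)

lemma bary_closed_interval: "bary_closed {x. \<bar>c - x i\<bar> \<le> (r::real)}"
  unfolding bary_closed_def
proof (intro allI impI)
  fix t :: "('a \<Rightarrow> real) list"
  assume ne: "t \<noteq> []" and sub: "set t \<subseteq> {x. \<bar>c - x i\<bar> \<le> r}"
  have "\<bar>real (length t) * c - (\<Sum>x\<leftarrow>t. x i)\<bar> \<le> real (length t) * r"
    using sub
  proof (induction t)
    case (Cons x t)
    then have "\<bar>c - x i\<bar> \<le> r" "\<bar>real (length t) * c - (\<Sum>x\<leftarrow>t. x i)\<bar> \<le> real (length t) * r"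
      by auto
    then show ?case
      by (simp add: algebra_simps)
  qed simp
  moreover have "c - bary t i = (real (length t) * c - (\<Sum>x\<leftarrow>t. x i)) / real (length t)"
    using ne by (simp add: bary_def field_simps)
  ultimately show "bary t \<in> {x. \<bar>c - x i\<bar> \<le> r}"
    using ne by (simp add: abs_divide pos_divide_le_eq mult.commute)
qed

text \<open>\<open>v\<close> itself contributes nothing to the deviation and each of the
  \<open>n\<close> other entries at most \<delta>, whence the contraction factor.\<close>

lemma bary_vertex_dist:
  assumes "length t = Suc n" "v \<in> set t" "\<And>x y. x \<in> set t \<Longrightarrow> y \<in> set t \<Longrightarrow> \<bar>x i - y i\<bar> \<le> \<delta>"
  shows "\<bar>bary t i - v i\<bar> \<le> real n / real (Suc n) * \<delta>"
proof -
  obtain t1 t2 where t: "t = t1 @ v # t2"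
    using assms(2) by (meson split_list)
  have bound: "\<bar>(\<Sum>x\<leftarrow>s. x i) - real (length s) * v i\<bar> \<le> real (length s) * \<delta>" if "set s \<subseteq> set t" for s
    using that
  proof (induction s)
    case (Cons x s)
    then have "\<bar>x i - v i\<bar> \<le> \<delta>" "\<bar>(\<Sum>x\<leftarrow>s. x i) - real (length s) * v i\<bar> \<le> real (length s) * \<delta>"
      using assms(2,3) by auto
    then show ?case
      by (simp add: algebra_simps)
  qed simp
  have n: "n = length (t1 @ t2)"
    using assms(1) t by simp
  have "bary t i - v i = ((\<Sum>x\<leftarrow>t1 @ t2. x i) - real n * v i) / real (Suc n)"
    unfolding bary_def assms(1) using t by (simp add: field_simps)
  moreover have "\<bar>(\<Sum>x\<leftarrow>t1 @ t2. x i) - real n * v i\<bar> \<le> real n * \<delta>"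
    unfolding n by (rule bound) (auto simp: t)
  ultimately show ?thesis
    by (simp add: abs_divide divide_right_mono del: of_nat_Suc)
qed

lemma ratio_mono: "n \<le> k \<Longrightarrow> real n / real (Suc n) \<le> real k / real (Suc k)"
  by (simp add: field_simps)

definition diam_le :: "('k \<Rightarrow> real) list \<Rightarrow> real \<Rightarrow> bool" where
  "diam_le t \<delta> \<longleftrightarrow> (\<forall>x\<in>set t. \<forall>y\<in>set t. \<forall>i. \<bar>x i - y i\<bar> \<le> \<delta>)"

lemma diam_leD: "diam_le t \<delta> \<Longrightarrow> x \<in> set t \<Longrightarrow> y \<in> set t \<Longrightarrow> \<bar>x i - y i\<bar> \<le> \<delta>"
  by (simp add: diam_le_def)

lemma diam_le_nonneg: "diam_le t \<delta> \<Longrightarrow> t \<noteq> [] \<Longrightarrow> 0 \<le> \<delta>"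
  using diam_leD [of t \<delta> "hd t" "hd t"] by simp

text \<open>Pairs within a subdivided face are settled by induction, pairs with the apex by
  \<open>bary_vertex_dist\<close> and the closedness of intervals under barycenters. The factor
  belongs to the top dimension \<open>k\<close>, so that one rate serves all levels of a
  tower.\<close>

lemma keys_sd_diam:
  assumes "s \<in> Poly_Mapping.keys (sd n t)" "length t = Suc n" "n \<le> k" "diam_le t \<delta>"
  shows "diam_le s (real k / real (Suc k) * \<delta>)"
  using assms
proof (induction n arbitrary: s t)
  case 0
  then have "0 \<le> \<delta>"
    using diam_le_nonneg by force
  then show ?case
    using 0 by (auto simp: sd_def diam_le_def split: if_splits)
next
  case (Suc n)
  let ?r = "real k / real (Suc k) * \<delta>"
  have "\<delta> \<ge> 0"
    using diam_le_nonneg [OF Suc.prems(4)] Suc.prems(2) by fastforce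
  then have "?r \<ge> 0" by simp
  have "s \<in> Poly_Mapping.keys (cone_on (bary t) (lin (sd n) (bdry t)))"
    using Suc.prems(1) by (auto simp: sd_def split: if_splits)
  then obtain s' t' where s: "s = bary t # s'" and t': "t' \<in> Poly_Mapping.keys (bdry t)"
    and s': "s' \<in> Poly_Mapping.keys (sd n t')"
    by (blast dest: keys_coneD keys_linD)
  have sub: "set t' \<subseteq> set t" and len: "length t' = Suc n"
    using t' keys_bdryD Suc.prems(2) by force+
  have apex: "\<bar>bary t i - z i\<bar> \<le> ?r" if "z \<in> set s'" for z i
  proof -
    have "set t \<subseteq> {x. \<bar>bary t i - x i\<bar> \<le> ?r}"
    proof clarify
      fix v assume "v \<in> set t"
      then have "\<bar>bary t i - v i\<bar> \<le> real (Suc n) / real (Suc (Suc n)) * \<delta>"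
        using bary_vertex_dist [OF Suc.prems(2), of v i \<delta>] diam_leD [OF Suc.prems(4)] by blast
      also have "\<dots> \<le> ?r"
        by (rule mult_right_mono [OF ratio_mono [OF Suc.prems(3)] \<open>\<delta> \<ge> 0\<close>])
      finally show "\<bar>bary t i - v i\<bar> \<le> ?r" .
    qed
    then have "set s' \<subseteq> {x. \<bar>bary t i - x i\<bar> \<le> ?r}"
      using keys_sd_subset [OF s' bary_closed_interval] sub by blast
    then show ?thesis using that by blast
  qed
  have "diam_le t' \<delta>"
    using Suc.prems(4) sub by (auto simp: diam_le_def)
  then have base: "diam_le s' ?r"
    using Suc.IH [OF s' len] Suc.prems(3) by simp
  show ?case
    unfolding diam_le_def
  proof (intro ballI allI)
    fix x y i assume "x \<in> set s" "y \<in> set s"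
    then consider "x = bary t" "y = bary t" | "x = bary t" "y \<in> set s'" | "x \<in> set s'" "y = bary t"
      | "x \<in> set s'" "y \<in> set s'"
      using s by auto
    then show "\<bar>x i - y i\<bar> \<le> ?r"
    proof cases
      case 1
      then show ?thesis using \<open>?r \<ge> 0\<close> by simp
    next
      case 2
      then show ?thesis using apex [of y i] by simp
    next
      case 3
      then show ?thesis using apex [of x i] by (simp add: abs_minus_commute)
    next
      case 4
      then show ?thesis using diam_leD [OF base] by simp
    qed
  qed
qed

text \<open>The carrier clause ranges over all barycentrically closed sets, so it composes under
  iteration; later \<open>C\<close> becomes a cell or a convex hull.\<close>

lemma sd_iterate_tower:
  assumes "tower k \<nu> h" and "\<And>t. bary (map \<nu> t) = \<nu> (bary t)"
    and "\<And>n t. n \<le> k \<Longrightarrow> t \<in> Poly_Mapping.keys (h n) \<Longrightarrow> diam_le t \<delta>"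
  shows "\<exists>h'. tower k \<nu> h' \<and> (\<forall>n\<le>k. \<forall>s\<in>Poly_Mapping.keys (h' n).
    (\<exists>t\<in>Poly_Mapping.keys (h n). \<forall>C. bary_closed C \<longrightarrow> set t \<subseteq> C \<longrightarrow> set s \<subseteq> C) \<and>
    diam_le s ((real k / real (Suc k)) ^ N * \<delta>))"
proof (induction N)
  case 0
  show ?case
    using assms by (intro exI [of _ h]) auto
next
  case (Suc N)
  let ?r = "real k / real (Suc k)"
  obtain h' where tower: "tower k \<nu> h'"
    and carrier: "\<And>n s. n \<le> k \<Longrightarrow> s \<in> Poly_Mapping.keys (h' n) \<Longrightarrow>
      \<exists>t\<in>Poly_Mapping.keys (h n). \<forall>C. bary_closed C \<longrightarrow> set t \<subseteq> C \<longrightarrow> set s \<subseteq> C"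
    and diam: "\<And>n s. n \<le> k \<Longrightarrow> s \<in> Poly_Mapping.keys (h' n) \<Longrightarrow> diam_le s (?r ^ N * \<delta>)"
    using Suc by blast
  show ?case
  proof (intro exI conjI allI impI ballI)
    show "tower k \<nu> (\<lambda>n. lin (sd n) (h' n))"
      using tower assms(2) by (rule sd_tower)
  next
    fix n s assume n: "n \<le> k" and "s \<in> Poly_Mapping.keys (lin (sd n) (h' n))"
    then obtain s' where s': "s' \<in> Poly_Mapping.keys (h' n)" and s: "s \<in> Poly_Mapping.keys (sd n s')"
      using keys_linD [of s "sd n" "h' n"] by blast
    show "\<exists>t\<in>Poly_Mapping.keys (h n). \<forall>C. bary_closed C \<longrightarrow> set t \<subseteq> C \<longrightarrow> set s \<subseteq> C"
      using carrier [OF n s'] keys_sd_subset [OF s] by blast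
    have "length s' = Suc n"
      using tower n s' by (auto simp: tower_def)
    then show "diam_le s (?r ^ Suc N * \<delta>)"
      using keys_sd_diam [OF s _ n diam [OF n s']] by (simp only: power_Suc mult.assoc)
  qed
qed

lemma fine_tower:
  assumes "tower k \<nu> h" and "\<And>t. bary (map \<nu> t) = \<nu> (bary t)"
    and "\<And>n t. n \<le> k \<Longrightarrow> t \<in> Poly_Mapping.keys (h n) \<Longrightarrow> diam_le t \<delta>"
    and "\<epsilon> > 0"
  obtains h' where "tower k \<nu> h'"
    and "\<And>n s. n \<le> k \<Longrightarrow> s \<in> Poly_Mapping.keys (h' n) \<Longrightarrow>
      \<exists>t\<in>Poly_Mapping.keys (h n). \<forall>C. bary_closed C \<longrightarrow> set t \<subseteq> C \<longrightarrow> set s \<subseteq> C"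
    and "\<And>n s. n \<le> k \<Longrightarrow> s \<in> Poly_Mapping.keys (h' n) \<Longrightarrow> diam_le s \<epsilon>"
proof -
  have "(\<lambda>N. (real k / real (Suc k)) ^ N * \<delta>) \<longlonglongrightarrow> 0 * \<delta>"
    by (intro tendsto_mult LIMSEQ_realpow_zero tendsto_const) auto
  then have "eventually (\<lambda>N. (real k / real (Suc k)) ^ N * \<delta> < \<epsilon>) sequentially"
    using assms(4) by (intro order_tendstoD) auto
  then obtain N where N: "(real k / real (Suc k)) ^ N * \<delta> < \<epsilon>"
    by (auto simp: eventually_sequentially)
  have weaken: "diam_le s \<epsilon>" if "diam_le s ((real k / real (Suc k)) ^ N * \<delta>)" for s :: "('a \<Rightarrow> real) list"
    using that N unfolding diam_le_def by (meson order_trans less_imp_le)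
  obtain h' where h': "tower k \<nu> h'"
    "\<forall>n\<le>k. \<forall>s\<in>Poly_Mapping.keys (h' n).
      (\<exists>t\<in>Poly_Mapping.keys (h n). \<forall>C. bary_closed C \<longrightarrow> set t \<subseteq> C \<longrightarrow> set s \<subseteq> C) \<and>
      diam_le s ((real k / real (Suc k)) ^ N * \<delta>)"
    using sd_iterate_tower [of k \<nu> h \<delta> N, OF assms(1,2)] assms(3) by blast
  show thesis
    by (rule that [OF h'(1)]) (use h'(2) weaken in blast)+
qed

section \<open>A tower in the deleted product of the skeleton\<close>

text \<open>A list of signed vertices \<open>(s, v)\<close> encodes the cell \<open>\<sigma> \<times> \<tau>\<close>, where \<open>\<sigma>\<close> and \<open>\<tau>\<close> collect
  the vertices with sign \<open>True\<close> and \<open>False\<close>.  With this encoding the cellular boundary of the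
  product becomes \<open>bdry\<close>, up to lists that lack one of the two signs.
  \<open>disj_pairs k a b\<close> is the sum of all pairs of disjoint subsets of \<open>{0..<k}\<close> of sizes
  \<open>a\<close> and \<open>b\<close>; integer sizes avoid case distinctions at \<open>0\<close>.\<close>

primrec disj_pairs :: "nat \<Rightarrow> int \<Rightarrow> int \<Rightarrow> (bool \<times> nat) list chain" where
  "disj_pairs 0 a b = (if a = 0 \<and> b = 0 then gen [] else 0)"
| "disj_pairs (Suc k) a b = disj_pairs k a b + cone_on (True, k) (disj_pairs k (a - 1) b) +
     cone_on (False, k) (disj_pairs k a (b - 1))"

definition flip :: "bool \<times> nat \<Rightarrow> bool \<times> nat" where
  "flip e = (\<not> fst e, snd e)"

lemma bdry_disj_pairs:
  "lin bdry (disj_pairs k a b) =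
     (if even (int k + a + b) then disj_pairs k (a - 1) b + disj_pairs k a (b - 1) else 0)"
proof (induction k arbitrary: a b)
  case 0
  show ?case by auto
next
  case (Suc k)
  show ?case
  proof (cases "even (int k + a + b)")
    case True
    then have "odd (int k + (a - 1) + b)" "odd (int k + a + (b - 1))" "odd (int (Suc k) + a + b)"
      by presburger+
    with True have "lin bdry (disj_pairs k a b) = disj_pairs k (a - 1) b + disj_pairs k a (b - 1)"
      "lin bdry (disj_pairs k (a - 1) b) = 0" "lin bdry (disj_pairs k a (b - 1)) = 0"
      by (simp_all only: Suc if_True if_False)
    then show ?thesis
      using \<open>odd (int (Suc k) + a + b)\<close>
      by (simp only: if_False disj_pairs.simps lin_add lin_bdry_cone cone_simps) (simp add: ac_simps)
  next
    case False
    then have "even (int k + (a - 1) + b)" "even (int k + a + (b - 1))" "even (int (Suc k) + a + b)"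
      by presburger+
    with False have "lin bdry (disj_pairs k a b) = 0"
      "lin bdry (disj_pairs k (a - 1) b) = disj_pairs k (a - 1 - 1) b + disj_pairs k (a - 1) (b - 1)"
      "lin bdry (disj_pairs k a (b - 1)) = disj_pairs k (a - 1) (b - 1) + disj_pairs k a (b - 1 - 1)"
      by (simp_all only: Suc if_True if_False)
    then show ?thesis
      using \<open>even (int (Suc k) + a + b)\<close>
      by (simp only: if_True disj_pairs.simps lin_add lin_bdry_cone cone_simps) (simp add: ac_simps)
  qed
qed

lemma disj_pairs_eq_0: "int k < a + b \<Longrightarrow> disj_pairs k a b = 0"
  by (induction k arbitrary: a b) auto

lemma chmap_flip_disj_pairs: "chmap (map flip) (disj_pairs k a b) = disj_pairs k b a"
  by (induction k arbitrary: a b) (simp_all add: chmap_cone flip_def ac_simps)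

text \<open>For \<open>n = 2 j\<close> the sum runs over the pairs of disjoint \<open>(j + 1)\<close>-subsets of
  \<open>{0..<2 j + 3}\<close> whose largest vertex lies in \<open>\<sigma>\<close>, and for \<open>n = 2 j + 1\<close> over the pairs in
  \<open>{0..<2 j + 4}\<close> with \<open>card \<sigma> = j + 2\<close>, \<open>card \<tau> = j + 1\<close> and \<open>2 j + 3 \<in> \<sigma>\<close>.  In top dimension
  \<open>2 d\<close> this is half of the mod 2 fundamental cycle of the deleted product.\<close>

definition cell_chain :: "nat \<Rightarrow> (bool \<times> nat) list chain" where
  "cell_chain n = (let j = n div 2 in
     if even n then cone_on (True, 2 * j + 2) (disj_pairs (2 * j + 2) (int j) (int j + 1)) +
       cone_on (True, 2 * j + 1) (disj_pairs (2 * j + 1) (int j) (int j + 1))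
     else cone_on (True, 2 * j + 3) (disj_pairs (2 * j + 3) (int j + 1) (int j + 1)))"

lemma cell_chain_even:
  "cell_chain (2 * j) = cone_on (True, 2 * j + 2) (disj_pairs (2 * j + 2) (int j) (int j + 1)) +
     cone_on (True, 2 * j + 1) (disj_pairs (2 * j + 1) (int j) (int j + 1))"
  by (simp add: cell_chain_def)

lemma cell_chain_odd:
  "cell_chain (Suc (2 * j)) = cone_on (True, 2 * j + 3) (disj_pairs (2 * j + 3) (int j + 1) (int j + 1))"
  by (simp add: cell_chain_def Let_def)

text \<open>The base of the cone is a cycle by parity, hence it is the whole boundary. It consists
  of all pairs of disjoint sets of \<open>j + 1\<close> among \<open>2 * j + 3\<close> vertices; the
  factor holding the largest vertex used splits it into a half and its flip.\<close>

lemma bdry_cell_chain_odd: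
  "lin bdry (cell_chain (Suc (2 * j))) = cell_chain (2 * j) + chmap (map flip) (cell_chain (2 * j))"
proof -
  have "lin bdry (cell_chain (Suc (2 * j))) = disj_pairs (2 * j + 3) (int j + 1) (int j + 1)"
    by (simp add: cell_chain_odd lin_bdry_cone bdry_disj_pairs del: disj_pairs.simps)
  also have "\<dots> = disj_pairs (Suc (2 * j + 2)) (int j + 1) (int j + 1)"
    by (simp add: numeral_3_eq_3)
  also have "\<dots> = disj_pairs (Suc (2 * j + 1)) (int j + 1) (int j + 1) +
      cone_on (True, 2 * j + 2) (disj_pairs (2 * j + 2) (int j) (int j + 1)) +
      cone_on (False, 2 * j + 2) (disj_pairs (2 * j + 2) (int j + 1) (int j))"
    unfolding disj_pairs.simps(2) [of "2 * j + 2"] by simp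
  \<comment> \<open>Without the vertex \<open>2 * j + 2\<close> all other \<open>2 * j + 2\<close>
    vertices are used, so \<open>2 * j + 1\<close> occurs.\<close>
  also have "disj_pairs (Suc (2 * j + 1)) (int j + 1) (int j + 1) =
      cone_on (True, 2 * j + 1) (disj_pairs (2 * j + 1) (int j) (int j + 1)) +
      cone_on (False, 2 * j + 1) (disj_pairs (2 * j + 1) (int j + 1) (int j))"
    unfolding disj_pairs.simps(2) [of "2 * j + 1"] by (simp add: disj_pairs_eq_0 del: disj_pairs.simps)
  finally show ?thesis
    unfolding cell_chain_even
    by (simp add: chmap_cone chmap_flip_disj_pairs flip_def ac_simps del: disj_pairs.simps)
qed

lemma bdry_cell_chain_even:
  "lin bdry (cell_chain (Suc (Suc (2 * j)))) =
     cell_chain (Suc (2 * j)) + chmap (map flip) (cell_chain (Suc (2 * j)))"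
proof -
  let ?P = "disj_pairs (2 * j + 3)"
  have eq: "Suc (Suc (2 * j)) = 2 * Suc j" "2 * Suc j + 2 = Suc (2 * j + 3)" "2 * Suc j + 1 = 2 * j + 3"
    by simp_all
  have "lin bdry (cell_chain (Suc (Suc (2 * j)))) =
     disj_pairs (Suc (2 * j + 3)) (int j + 1) (int j + 2) + ?P (int j + 1) (int j + 2) +
     cone_on (True, 2 * j + 3) (?P (int j) (int j + 2) + ?P (int j + 1) (int j + 1))"
    unfolding eq cell_chain_even
    by (simp add: lin_bdry_cone bdry_disj_pairs ac_simps del: disj_pairs.simps)
  \<comment> \<open>Splitting the first summand at the vertex \<open>2 * j + 3\<close> cancels the
    second summand and the cone over the sizes \<open>j\<close> and \<open>j + 2\<close>.\<close>
  also have "\<dots> = cone_on (True, 2 * j + 3) (?P (int j + 1) (int j + 1)) +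
      cone_on (False, 2 * j + 3) (?P (int j + 1) (int j + 1))"
    unfolding disj_pairs.simps(2) by (simp add: ac_simps del: disj_pairs.simps)
  finally show ?thesis
    by (simp add: cell_chain_odd chmap_cone chmap_flip_disj_pairs flip_def del: disj_pairs.simps)
qed

lemma bdry_cell_chain:
  "lin bdry (cell_chain (Suc n)) = cell_chain n + chmap (map flip) (cell_chain n)"
proof (cases "even n")
  case True
  then obtain j where "n = 2 * j" by blast
  then show ?thesis by (simp add: bdry_cell_chain_odd)
next
  case False
  then obtain j where "n = Suc (2 * j)" by (metis oddE Suc_eq_plus1)
  then show ?thesis by (simp add: bdry_cell_chain_even)
qed

abbreviation side :: "bool \<Rightarrow> (bool \<times> nat) list \<Rightarrow> (bool \<times> nat) list" where
  "side s t \<equiv> filter (\<lambda>e. fst e = s) t"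

lemma keys_disj_pairsD:
  "t \<in> Poly_Mapping.keys (disj_pairs k a b) \<Longrightarrow>
     distinct (map snd t) \<and> snd ` set t \<subseteq> {..<k} \<and>
     int (length (side True t)) = a \<and> int (length (side False t)) = b"
proof (induction k arbitrary: t a b)
  case 0
  then show ?case by (auto split: if_splits)
next
  case (Suc k)
  then have "t \<in> Poly_Mapping.keys (disj_pairs k a b) \<or>
      t \<in> Poly_Mapping.keys (cone_on (True, k) (disj_pairs k (a - 1) b)) \<or>
      t \<in> Poly_Mapping.keys (cone_on (False, k) (disj_pairs k a (b - 1)))"
    unfolding disj_pairs.simps(2) by (blast dest: subsetD [OF keys_add])
  then consider "t \<in> Poly_Mapping.keys (disj_pairs k a b)"
    | s where "t = (True, k) # s" "s \<in> Poly_Mapping.keys (disj_pairs k (a - 1) b)"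
    | s where "t = (False, k) # s" "s \<in> Poly_Mapping.keys (disj_pairs k a (b - 1))"
    by (blast dest: keys_coneD)
  then show ?case
  proof cases
    case 1
    then show ?thesis using Suc.IH by fastforce
  next
    case (2 s)
    then show ?thesis using Suc.IH [OF 2(2)] by fastforce
  next
    case (3 s)
    then show ?thesis using Suc.IH [OF 3(2)] by fastforce
  qed
qed

lemma length_sides: "length t = length (side True t) + length (side False t)"
  by (induction t) auto

text \<open>Both sides have size \<open>j + 1\<close> for \<open>n = 2 * j\<close>, and at most
  \<open>j + 2\<close> for \<open>n = Suc (2 * j)\<close>, where \<open>n \<le> 2 * d\<close> forces
  \<open>j < d\<close>.\<close>

lemma keys_cell_chainD:
  assumes "t \<in> Poly_Mapping.keys (cell_chain n)" "n \<le> 2 * d"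
  shows "length t = n + 2 \<and> distinct (map snd t) \<and> snd ` set t \<subseteq> {..2 * d + 2} \<and>
    (\<forall>s. length (side s t) \<le> d + 1)"
proof (cases "even n")
  case True
  then obtain j where n: "n = 2 * j" by blast
  then consider s where "t = (True, 2 * j + 2) # s" "s \<in> Poly_Mapping.keys (disj_pairs (2 * j + 2) (int j) (int j + 1))"
    | s where "t = (True, 2 * j + 1) # s" "s \<in> Poly_Mapping.keys (disj_pairs (2 * j + 1) (int j) (int j + 1))"
    using assms(1) unfolding n cell_chain_even by (blast dest: subsetD [OF keys_add] keys_coneD)
  then show ?thesis
  proof cases
    case (1 s)
    then show ?thesis using keys_disj_pairsD [OF 1(2)] assms(2) n length_sides [of t]
      by (auto simp: all_bool_eq)
  next
    case (2 s)
    then show ?thesis using keys_disj_pairsD [OF 2(2)] assms(2) n length_sides [of t]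
      by (auto simp: all_bool_eq)
  qed
next
  case False
  then obtain j where n: "n = Suc (2 * j)" by (metis oddE Suc_eq_plus1)
  then obtain s where s: "t = (True, 2 * j + 3) # s"
    "s \<in> Poly_Mapping.keys (disj_pairs (2 * j + 3) (int j + 1) (int j + 1))"
    using assms(1) unfolding n cell_chain_odd by (blast dest: keys_coneD)
  then show ?thesis
    using keys_disj_pairsD [OF s(2)] assms(2) n length_sides [of t]
    by (auto simp: all_bool_eq)
qed

definition two_sided :: "(bool \<times> nat) list \<Rightarrow> bool" where
  "two_sided t \<longleftrightarrow> (\<forall>s. \<exists>e\<in>set t. fst e = s)"

definition cell_bary :: "(bool \<times> nat) list \<Rightarrow> bool \<times> nat \<Rightarrow> real" where
  "cell_bary t = (\<lambda>e. real (count_list t e) / real (length (side (fst e) t)))"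

definition swap_pt :: "(bool \<times> nat \<Rightarrow> real) \<Rightarrow> bool \<times> nat \<Rightarrow> real" where
  "swap_pt p = (\<lambda>e. p (flip e))"

lemma cell_bary_flip: "cell_bary (map flip t) = swap_pt (cell_bary t)"
proof -
  have "count_list (map flip t) e = count_list t (flip e)" for e
    by (induction t) (auto simp: flip_def)
  moreover have "length (side s (map flip t)) = length (side (\<not> s) t)" for s
    by (induction t) (auto simp: flip_def)
  ultimately show ?thesis
    by (simp add: cell_bary_def swap_pt_def flip_def)
qed

lemma two_sided_flip: "two_sided (map flip t) = two_sided t"
  by (auto simp: two_sided_def flip_def all_bool_eq)

text \<open>All three lists are genuine pairs of vertices, and three is odd; this gives the odd
  number of points at the bottom of the tower.\<close>

lemma lin_two_sided_cell_chain_0: "lin (\<lambda>t. of_bool (two_sided t)) (cell_chain 0) = (1::bit)"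
proof -
  have "cell_chain 0 = gen [(True, 2), (False, 1)] + gen [(True, 2), (False, 0)] + gen [(True, 1), (False, 0)]"
    by (simp add: cell_chain_def numeral_2_eq_2 ac_simps)
  then show ?thesis
    by (simp add: two_sided_def all_bool_eq)
qed

text \<open>If both signs occur, one occurs twice: dropping either of these two entries keeps both
  signs, dropping the third does not. With one sign only, no face counts.\<close>

lemma lin_two_sided_bdry:
  assumes "length t = Suc 2"
  shows "lin (\<lambda>s. of_bool (two_sided s)) (bdry t) = (0::bit)"
proof -
  obtain x y z where t: "t = [x, y, z]"
    using assms by (auto simp: length_Suc_conv numeral_2_eq_2)
  show ?thesis
    unfolding t by (cases "fst x"; cases "fst y"; cases "fst z") (simp_all add: two_sided_def all_bool_eq)
qed

theorem cell_tower: "tower k swap_pt (\<lambda>n. lin (csub two_sided cell_bary n) (cell_chain n))"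
proof (rule csub_tower [where r = 2 and \<nu> = flip])
  show "two_sided t" if "s \<in> Poly_Mapping.keys (bdry t)" "two_sided s" for s t
    using keys_bdryD [OF that(1)] that(2) unfolding two_sided_def by blast
  show "length t = n + 2" if "n \<le> k" "t \<in> Poly_Mapping.keys (cell_chain n)" for n t
    using keys_cell_chainD [OF that(2), of n] by simp
qed (simp_all add: lin_two_sided_bdry bdry_cell_chain lin_two_sided_cell_chain_0 two_sided_flip
    cell_bary_flip)

section \<open>Geometric cells in the deleted product\<close>

definition cell :: "nat \<Rightarrow> (bool \<times> nat) list \<Rightarrow> (bool \<times> nat \<Rightarrow> real) set" where
  "cell N t = {p. (\<forall>e. 0 \<le> p e \<and> (p e \<noteq> 0 \<longrightarrow> e \<in> set t)) \<and> (\<forall>s. (\<Sum>i\<le>N. p (s, i)) = 1)}"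

lemma bary_closed_cell: "bary_closed (cell N c)"
  unfolding bary_closed_def
proof (intro allI impI)
  fix t assume ne: "t \<noteq> []" and sub: "set t \<subseteq> cell N c"
  have nonneg: "0 \<le> (\<Sum>x\<leftarrow>t. x e)" for e
    using sub by (intro sum_list_nonneg) (auto simp: cell_def simp del: split_paired_All)
  have supp: "(\<Sum>x\<leftarrow>t. x e) = 0" if "e \<notin> set c" for e
  proof -
    have "map (\<lambda>x. x e) t = map (\<lambda>x. 0) t"
      using sub that by (auto simp: cell_def simp del: split_paired_All)
    then show ?thesis by (simp only: sum_list_0)
  qed
  have "(\<Sum>i\<le>N. \<Sum>x\<leftarrow>t. x (s, i)) = real (length t)" for s
    using sub by (induction t) (auto simp: sum.distrib cell_def)
  moreover have "e \<in> set c" if "(\<Sum>x\<leftarrow>t. x e) \<noteq> 0" for e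
    using supp that by blast
  ultimately show "bary t \<in> cell N c"
    using ne nonneg by (auto simp: cell_def bary_def sum_divide_distrib [symmetric])
qed

lemma cell_bary_in_cell:
  assumes "two_sided t" "set t \<subseteq> set c" "snd ` set c \<subseteq> {..N}"
  shows "cell_bary t \<in> cell N c"
proof -
  have "(\<Sum>i\<le>N. count_list t (s, i)) = length (side s t)" for s
    using assms(2,3)
  proof (induction t)
    case (Cons e t)
    have "(\<Sum>i\<le>N. count_list (e # t) (s, i)) = (\<Sum>i\<le>N. count_list t (s, i) + (if e = (s, i) then 1 else 0))"
      by (intro sum.cong) auto
    also have "\<dots> = length (side s t) + (\<Sum>i\<le>N. if e = (s, i) then 1 else 0)"
      using Cons by (simp add: sum.distrib)
    also have "(\<Sum>i\<le>N. if e = (s, i) then 1 else (0::nat)) = (\<Sum>i\<le>N. if i = snd e then (if fst e = s then 1 else 0) else 0)"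
      by (intro sum.cong) (auto simp: prod_eq_iff)
    also have "\<dots> = (if fst e = s then 1 else 0)"
      using Cons.prems by (auto simp: image_subset_iff)
    finally show ?case by simp
  qed simp
  moreover have "side s t \<noteq> []" for s
    using assms(1) by (auto simp: two_sided_def filter_empty_conv)
  ultimately have "(\<Sum>i\<le>N. cell_bary t (s, i)) = 1" for s
    unfolding cell_bary_def fst_conv sum_divide_distrib [symmetric] of_nat_sum [symmetric] by simp
  then show ?thesis
    using assms(2) by (auto simp: cell_def cell_bary_def count_list_0_iff)
qed

definition deleted_product :: "nat \<Rightarrow> nat \<Rightarrow> ((nat \<Rightarrow> real) \<times> (nat \<Rightarrow> real)) set" where
  "deleted_product d N = {(x, y). x \<in> skeleton d N \<and> y \<in> skeleton d N \<and> (\<forall>i. x i * y i = 0)}"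

definition pt_pair :: "(bool \<times> nat \<Rightarrow> real) \<Rightarrow> (nat \<Rightarrow> real) \<times> (nat \<Rightarrow> real)" where
  "pt_pair p = (\<lambda>i. p (True, i), \<lambda>i. p (False, i))"

lemma cell_deleted_product:
  assumes p: "p \<in> cell (2 * d + 2) c" and c: "distinct (map snd c)" "snd ` set c \<subseteq> {..2 * d + 2}"
    "\<And>s. length (side s c) \<le> d + 1"
  shows "pt_pair p \<in> deleted_product d (2 * d + 2)"
proof -
  have skel: "(\<lambda>i. p (s, i)) \<in> skeleton d (2 * d + 2)" for s
  proof -
    have "{i. p (s, i) \<noteq> 0} \<subseteq> snd ` set (side s c)"
      using p by (force simp: cell_def)
    then have "card {i. p (s, i) \<noteq> 0} \<le> card (snd ` set (side s c))"
      by (intro card_mono) auto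
    also have "\<dots> \<le> d + 1"
      using c(3) [of s] card_image_le [of "set (side s c)" snd] card_length [of "side s c"] by simp
    finally show ?thesis
      using p c(2) by (force simp: cell_def skeleton_def)
  qed
  have "p (True, i) * p (False, i) = 0" for i
  proof (rule ccontr)
    assume "p (True, i) * p (False, i) \<noteq> 0"
    then have "(True, i) \<in> set c" "(False, i) \<in> set c"
      using p by (auto simp: cell_def)
    moreover have "inj_on snd (set c)"
      using c(1) by (simp add: distinct_map)
    ultimately show False
      using inj_onD [of snd "set c" "(True, i)" "(False, i)"] by simp
  qed
  then show ?thesis
    using skel by (auto simp: deleted_product_def pt_pair_def)
qed

lemma bary_swap_pt: "bary (map swap_pt t) = swap_pt (bary t)"
  by (simp add: bary_def swap_pt_def o_def)

text \<open>Cells serve as carriers: they contain the coarse simplices, are closed under barycenters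
  and lie in the deleted product, so all refinements stay there.\<close>

theorem fine_deleted_product_tower:
  assumes "\<epsilon> > 0"
  obtains h where "tower (2 * d) swap_pt h"
    and "\<forall>n\<le>2 * d. \<forall>t\<in>Poly_Mapping.keys (h n). diam_le t \<epsilon> \<and>
      (\<forall>x\<in>set t. pt_pair x \<in> deleted_product d (2 * d + 2))"
proof -
  let ?N = "2 * d + 2"
  define h where "h n = lin (csub two_sided cell_bary n) (cell_chain n)" for n
  have tower: "tower (2 * d) swap_pt h"
    unfolding h_def by (rule cell_tower)
  have carrier: "\<exists>c. set t \<subseteq> cell ?N c \<and> cell ?N c \<subseteq> pt_pair -` deleted_product d ?N"
    if n: "n \<le> 2 * d" and "t \<in> Poly_Mapping.keys (h n)" for n t
  proof -
    obtain c where c: "c \<in> Poly_Mapping.keys (cell_chain n)"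
      and t: "t \<in> Poly_Mapping.keys (csub two_sided cell_bary n c)"
      using \<open>t \<in> _\<close> unfolding h_def by (blast dest: keys_linD)
    note props = keys_cell_chainD [OF c n]
    have "set t \<subseteq> cell ?N c"
    proof
      fix x assume "x \<in> set t"
      then obtain t' where "two_sided t'" "set t' \<subseteq> set c" "x = cell_bary t'"
        using keys_csubD [OF t] by blast
      then show "x \<in> cell ?N c"
        using cell_bary_in_cell props by blast
    qed
    moreover have "cell ?N c \<subseteq> pt_pair -` deleted_product d ?N"
    proof
      fix p assume "p \<in> cell ?N c"
      then show "p \<in> pt_pair -` deleted_product d ?N"
        using cell_deleted_product [of p d c] props by simp
    qed
    ultimately show ?thesis by blast
  qed
  \<comment> \<open>Coordinates between 0 and 1 give the initial mesh 1.\<close>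
  have unit: "0 \<le> x e \<and> x e \<le> 1" if "x \<in> cell ?N c" "cell ?N c \<subseteq> pt_pair -` deleted_product d ?N" for x c e
  proof (cases "snd e \<le> ?N")
    case True
    have "x (fst e, snd e) \<le> (\<Sum>i\<le>?N. x (fst e, i))"
      using that(1) True by (intro member_le_sum [where f = "\<lambda>i. x (fst e, i)"]) (auto simp: cell_def)
    then show ?thesis
      using that(1) by (simp add: cell_def del: split_paired_All sum.atMost_Suc)
  next
    case False
    have "pt_pair x \<in> deleted_product d ?N"
      using that by blast
    then have "x (fst e, snd e) = 0"
      using False by (cases "fst e") (auto simp: deleted_product_def pt_pair_def skeleton_def)
    then show ?thesis by simp
  qed
  have bound: "diam_le t 1" if n: "n \<le> 2 * d" and t: "t \<in> Poly_Mapping.keys (h n)" for n t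
  proof -
    obtain c where c: "set t \<subseteq> cell ?N c" "cell ?N c \<subseteq> pt_pair -` deleted_product d ?N"
      using carrier [OF n t] by blast
    show ?thesis
      unfolding diam_le_def
    proof (intro ballI allI)
      fix x y e assume "x \<in> set t" "y \<in> set t"
      then have "0 \<le> x e \<and> x e \<le> 1" "0 \<le> y e \<and> y e \<le> 1"
        using c(1) unit [OF _ c(2)] by blast+
      then show "\<bar>x e - y e\<bar> \<le> 1" by linarith
    qed
  qed
  show thesis
  proof (rule fine_tower [OF tower bary_swap_pt, of 1 \<epsilon>])
    show "diam_le t 1" if "n \<le> 2 * d" "t \<in> Poly_Mapping.keys (h n)" for n t
      using that by (rule bound)
    show "0 < \<epsilon>" by fact
    fix h' assume h': "tower (2 * d) swap_pt h'"
      "\<And>n s. n \<le> 2 * d \<Longrightarrow> s \<in> Poly_Mapping.keys (h' n) \<Longrightarrow>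
        \<exists>t\<in>Poly_Mapping.keys (h n). \<forall>C. bary_closed C \<longrightarrow> set t \<subseteq> C \<longrightarrow> set s \<subseteq> C"
      "\<And>n s. n \<le> 2 * d \<Longrightarrow> s \<in> Poly_Mapping.keys (h' n) \<Longrightarrow> diam_le s \<epsilon>"
    have "pt_pair x \<in> deleted_product d ?N"
      if n: "n \<le> 2 * d" and s: "s \<in> Poly_Mapping.keys (h' n)" and x: "x \<in> set s" for n s x
    proof -
      obtain t where t: "t \<in> Poly_Mapping.keys (h n)" "\<forall>C. bary_closed C \<longrightarrow> set t \<subseteq> C \<longrightarrow> set s \<subseteq> C"
        using h'(2) [OF n s] by blast
      obtain c where c: "set t \<subseteq> cell ?N c" "cell ?N c \<subseteq> pt_pair -` deleted_product d ?N"
        using carrier [OF n t(1)] by blast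
      have "set s \<subseteq> cell ?N c"
        using t(2) bary_closed_cell c(1) by blast
      then show ?thesis
        using c(2) x by blast
    qed
    then show thesis
      using that [OF h'(1)] h'(3) by blast
  qed
qed

section \<open>Towers of spread-out unit vectors\<close>

definition hull_list :: "('k \<Rightarrow> real) list \<Rightarrow> ('k \<Rightarrow> real) set" where
  "hull_list t = {x. \<exists>w. (\<forall>i<length t. 0 \<le> w i) \<and> (\<Sum>i<length t. w i) = 1 \<and>
     (\<forall>j. x j = (\<Sum>i<length t. w i * (t ! i) j))}"

lemma set_subset_hull_list: "set t \<subseteq> hull_list t"
proof
  fix x assume "x \<in> set t"
  then obtain k where k: "k < length t" "x = t ! k"
    by (auto simp: in_set_conv_nth)
  show "x \<in> hull_list t"
    unfolding hull_list_def
  proof (intro CollectI exI [of _ "\<lambda>i. of_bool (i = k)"] conjI allI impI)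
    show "(\<Sum>i<length t. of_bool (i = k)) = (1::real)"
      using k by (simp add: of_bool_def)
    fix j
    have "(\<Sum>i<length t. of_bool (i = k) * (t ! i) j) = (\<Sum>i<length t. if i = k then (t ! i) j else 0)"
      by (rule sum.cong) auto
    then show "x j = (\<Sum>i<length t. of_bool (i = k) * (t ! i) j)"
      using k by simp
  qed simp
qed

lemma bary_closed_hull_list: "bary_closed (hull_list t)"
  unfolding bary_closed_def
proof (intro allI impI)
  fix u assume ne: "u \<noteq> []" and sub: "set u \<subseteq> hull_list t"
  let ?I = "{..<length t}"
  have "\<exists>w. (\<forall>i<length t. 0 \<le> w i) \<and> (\<Sum>i\<in>?I. w i) = real (length u) \<and>
      (\<forall>j. (\<Sum>x\<leftarrow>u. x j) = (\<Sum>i\<in>?I. w i * (t ! i) j))"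
    using sub
  proof (induction u)
    case Nil
    show ?case by (intro exI [of _ "\<lambda>_. 0"]) simp
  next
    case (Cons x u)
    then obtain w where "\<forall>i<length t. 0 \<le> w i" "(\<Sum>i\<in>?I. w i) = real (length u)"
        "\<forall>j. (\<Sum>x\<leftarrow>u. x j) = (\<Sum>i\<in>?I. w i * (t ! i) j)"
      by auto
    moreover obtain v where "\<forall>i<length t. 0 \<le> v i" "(\<Sum>i\<in>?I. v i) = 1"
        "\<forall>j. x j = (\<Sum>i\<in>?I. v i * (t ! i) j)"
      using Cons.prems by (simp add: hull_list_def) blast
    ultimately show ?case
      by (intro exI [of _ "\<lambda>i. v i + w i"]) (simp add: sum.distrib algebra_simps)
  qed
  then obtain w where "\<forall>i<length t. 0 \<le> w i" "(\<Sum>i\<in>?I. w i) = real (length u)"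
      "\<forall>j. (\<Sum>x\<leftarrow>u. x j) = (\<Sum>i\<in>?I. w i * (t ! i) j)"
    by blast
  then show "bary u \<in> hull_list t"
    using ne unfolding hull_list_def bary_def
    by (intro CollectI exI [of _ "\<lambda>i. w i / real (length u)"])
      (simp add: sum_divide_distrib [symmetric])
qed

lemma vinner_combination:
  assumes "\<And>j. x j = (\<Sum>a<n. w a * u a j)"
  shows "vinner m x x = (\<Sum>a<n. \<Sum>b<n. w a * w b * vinner m (u a) (u b))"
proof -
  have "vinner m x x = (\<Sum>j<m. \<Sum>a<n. \<Sum>b<n. w a * w b * (u a j * u b j))"
    unfolding vinner_def assms by (simp add: sum_product mult_ac)
  also have "\<dots> = (\<Sum>a<n. \<Sum>j<m. \<Sum>b<n. w a * w b * (u a j * u b j))"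
    by (rule sum.swap)
  also have "\<dots> = (\<Sum>a<n. \<Sum>b<n. \<Sum>j<m. w a * w b * (u a j * u b j))"
    by (intro sum.cong refl sum.swap)
  finally show ?thesis
    by (simp add: vinner_def sum_distrib_left)
qed

text \<open>With weights of sum 1, the squared norm is at least \<open>s + (1 - s) * q\<close> for
  \<open>q\<close> the sum of the squared weights, and \<open>q \<ge> 1 / (m + 1)\<close> by
  Cauchy-Schwarz. For \<open>m > 0\<close> the bound is positive exactly if
  \<open>s > - 1 / m\<close>, where \<open>- 1 / m\<close> is the inner product of two vertices of a
  regular simplex in the unit sphere of R^m.\<close>

lemma hull_list_norm_lower_bound:
  assumes len: "0 < length t" "length t \<le> m + 1"
    and unit: "\<And>x. x \<in> set t \<Longrightarrow> vinner m x x = 1"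
    and inner: "\<And>x y. x \<in> set t \<Longrightarrow> y \<in> set t \<Longrightarrow> s \<le> vinner m x y"
    and x: "x \<in> hull_list t"
  shows "(1 + s * real m) / (real m + 1) \<le> vinner m x x"
proof -
  let ?n = "length t"
  obtain w where w: "\<And>i. i < ?n \<Longrightarrow> 0 \<le> w i" "(\<Sum>i<?n. w i) = 1"
    "\<And>j. x j = (\<Sum>i<?n. w i * (t ! i) j)"
    using x by (auto simp: hull_list_def)
  define q where "q = (\<Sum>a<?n. (w a)\<^sup>2)"
  have "s \<le> 1"
    using inner [of "hd t" "hd t"] unit [of "hd t"] len(1) by simp
  have "(\<Sum>a<?n. w a)\<^sup>2 \<le> q * real (card {..<?n})"
    unfolding q_def by (rule sum_squared_le_sum_of_squares)
  then have "1 \<le> q * real ?n"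
    using w(2) by simp
  also have "\<dots> \<le> q * (real m + 1)"
    using len(2) by (intro mult_left_mono) (auto simp: q_def sum_nonneg)
  finally have q: "1 / (real m + 1) \<le> q"
    by (simp add: pos_divide_le_eq)
  have "(1 + s * real m) / (real m + 1) = s + (1 - s) * (1 / (real m + 1))"
    by (simp add: field_simps)
  also have "\<dots> \<le> s + (1 - s) * q"
    using q \<open>s \<le> 1\<close> by (intro add_left_mono mult_left_mono) auto
  also have "\<dots> = s * (\<Sum>a<?n. w a)\<^sup>2 + (1 - s) * q"
    by (simp add: w(2))
  also have "\<dots> = (\<Sum>a<?n. \<Sum>b<?n. w a * w b * (s + (if a = b then 1 - s else 0)))"
    by (simp add: power2_eq_square sum_product q_def distrib_left sum.distrib sum_distrib_left
        sum_distrib_right if_distrib [of "\<lambda>z. _ * z"] mult_ac cong: if_cong)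
  also have "\<dots> \<le> (\<Sum>a<?n. \<Sum>b<?n. w a * w b * vinner m (t ! a) (t ! b))"
    using w(1) inner unit by (intro sum_mono mult_left_mono) auto
  also have "\<dots> = vinner m x x"
    by (rule vinner_combination [symmetric]) (rule w(3))
  finally show ?thesis .
qed

definition neg_vec :: "(nat \<Rightarrow> real) \<Rightarrow> nat \<Rightarrow> real" where
  "neg_vec x = (\<lambda>i. - x i)"

lemma bary_neg_vec: "bary (map neg_vec t) = neg_vec (bary t)"
proof -
  have "(\<Sum>x\<leftarrow>t. - x i) = - (\<Sum>x\<leftarrow>t. x i)" for i
    by (induction t) auto
  then show ?thesis
    by (simp add: bary_def neg_vec_def o_def)
qed

text \<open>The choice sees absolute values only, hence is the same for \<open>x\<close> and
  \<open>neg_vec x\<close>.\<close>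

definition top_index :: "nat \<Rightarrow> (nat \<Rightarrow> real) \<Rightarrow> nat" where
  "top_index m x = (SOME i. i < m \<and> (\<forall>j<m. \<bar>x j\<bar> \<le> \<bar>x i\<bar>))"

lemma top_index:
  assumes "0 < m"
  shows "top_index m x < m" and "\<And>j. j < m \<Longrightarrow> \<bar>x j\<bar> \<le> \<bar>x (top_index m x)\<bar>"
proof -
  have "finite ((\<lambda>i. \<bar>x i\<bar>) ` {..<m})" "(\<lambda>i. \<bar>x i\<bar>) ` {..<m} \<noteq> {}"
    using assms by auto
  then have "Max ((\<lambda>i. \<bar>x i\<bar>) ` {..<m}) \<in> (\<lambda>i. \<bar>x i\<bar>) ` {..<m}"
    by (rule Max_in)
  then obtain i where "i < m" "\<bar>x i\<bar> = Max ((\<lambda>i. \<bar>x i\<bar>) ` {..<m})"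
    by auto
  then have "\<exists>i. i < m \<and> (\<forall>j<m. \<bar>x j\<bar> \<le> \<bar>x i\<bar>)"
    by auto
  from someI_ex [OF this]
  show "top_index m x < m" "\<And>j. j < m \<Longrightarrow> \<bar>x j\<bar> \<le> \<bar>x (top_index m x)\<bar>"
    unfolding top_index_def by auto
qed

lemma top_index_neg_vec: "top_index m (neg_vec x) = top_index m x"
  by (simp add: top_index_def neg_vec_def)

lemma top_index_large:
  assumes "0 < m" "\<kappa> \<le> vinner m x x"
  shows "sqrt (\<kappa> / real m) \<le> \<bar>x (top_index m x)\<bar>"
proof -
  have "vinner m x x \<le> (\<Sum>i<m. (x (top_index m x))\<^sup>2)"
    unfolding vinner_def
  proof (rule sum_mono)
    fix i assume "i \<in> {..<m}"
    then have "\<bar>x i\<bar>\<^sup>2 \<le> \<bar>x (top_index m x)\<bar>\<^sup>2"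
      using top_index(2) [OF assms(1)] by (intro power_mono) auto
    then show "x i * x i \<le> (x (top_index m x))\<^sup>2"
      by (simp add: power2_eq_square)
  qed
  then have "\<kappa> / real m \<le> (x (top_index m x))\<^sup>2"
    using assms by (simp add: pos_divide_le_eq mult.commute)
  then show ?thesis
    by (metis real_sqrt_abs real_sqrt_le_mono)
qed

lemma unit_coord_le_1:
  assumes "vinner m x x = 1" "\<And>i. i \<ge> m \<Longrightarrow> x i = 0"
  shows "\<bar>x i\<bar> \<le> 1"
proof (cases "i < m")
  case True
  have "x i * x i \<le> (\<Sum>i<m. x i * x i)"
    using True by (intro member_le_sum [where f = "\<lambda>i. x i * x i"]) auto
  then have "(x i)\<^sup>2 \<le> 1"
    using assms(1) by (simp add: vinner_def power2_eq_square)
  then show ?thesis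
    by (simp add: abs_square_le_1)
next
  case False
  then show ?thesis using assms(2) by simp
qed

text \<open>Points of the hulls have a coordinate of absolute value at least \<epsilon>. On a
  simplex of mesh \<epsilon> this coordinate cannot take both signs, which would differ by
  \<open>2 * \<epsilon>\<close>, so \<open>Fan_no_tower\<close> applies with the \<open>m\<close>
  coordinates as labels.\<close>

theorem no_spread_tower:
  assumes m: "0 < m" and tower: "tower m neg_vec h" and s: "- 1 / real m < s"
    and unit: "\<And>n t x. n \<le> m \<Longrightarrow> t \<in> Poly_Mapping.keys (h n) \<Longrightarrow> x \<in> set t \<Longrightarrow>
      vinner m x x = 1 \<and> (\<forall>i\<ge>m. x i = 0)"
    and inner: "\<And>n t x y. n \<le> m \<Longrightarrow> t \<in> Poly_Mapping.keys (h n) \<Longrightarrow> x \<in> set t \<Longrightarrow> y \<in> set t \<Longrightarrow>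
      s \<le> vinner m x y"
  shows False
proof -
  define \<kappa> where "\<kappa> = (1 + s * real m) / (real m + 1)"
  define \<epsilon> where "\<epsilon> = sqrt (\<kappa> / real m)"
  have "0 < 1 + s * real m"
    using s m by (simp add: field_simps)
  then have "\<epsilon> > 0"
    using m by (simp add: \<epsilon>_def \<kappa>_def)
  have diam: "diam_le t 2" if "n \<le> m" "t \<in> Poly_Mapping.keys (h n)" for n t
    unfolding diam_le_def
  proof (intro ballI allI)
    fix x y i assume "x \<in> set t" "y \<in> set t"
    then have "\<bar>x i\<bar> \<le> 1" "\<bar>y i\<bar> \<le> 1"
      using unit [OF that] by (blast intro: unit_coord_le_1)+
    then show "\<bar>x i - y i\<bar> \<le> 2" by linarith
  qed
  show False
  proof (rule fine_tower [OF tower bary_neg_vec, of 2 \<epsilon>])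
    show "diam_le t 2" if "n \<le> m" "t \<in> Poly_Mapping.keys (h n)" for n t
      using that by (rule diam)
    show "0 < \<epsilon>" by fact
    fix h' assume h': "tower m neg_vec h'"
      and carrier: "\<And>n s. n \<le> m \<Longrightarrow> s \<in> Poly_Mapping.keys (h' n) \<Longrightarrow>
        \<exists>t\<in>Poly_Mapping.keys (h n). \<forall>C. bary_closed C \<longrightarrow> set t \<subseteq> C \<longrightarrow> set s \<subseteq> C"
      and fine: "\<And>n s. n \<le> m \<Longrightarrow> s \<in> Poly_Mapping.keys (h' n) \<Longrightarrow> diam_le s \<epsilon>"
    have large: "\<epsilon> \<le> \<bar>x (top_index m x)\<bar>"
      if n: "n \<le> m" and s: "s \<in> Poly_Mapping.keys (h' n)" and x: "x \<in> set s" for n s x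
    proof -
      obtain t where t: "t \<in> Poly_Mapping.keys (h n)"
        and "\<forall>C. bary_closed C \<longrightarrow> set t \<subseteq> C \<longrightarrow> set s \<subseteq> C"
        using carrier [OF n s] by blast
      then have "x \<in> hull_list t"
        using bary_closed_hull_list set_subset_hull_list x by blast
      moreover have "length t = Suc n"
        using tower n t by (auto simp: tower_def)
      ultimately have "\<kappa> \<le> vinner m x x"
        unfolding \<kappa>_def using n unit [OF n t] inner [OF n t]
        by (intro hull_list_norm_lower_bound) auto
      then show ?thesis
        unfolding \<epsilon>_def by (rule top_index_large [OF m])
    qed
    show False
    proof (rule Fan_no_tower [OF h', where p = "\<lambda>x. 0 < x (top_index m x)" and idx = "top_index m"])
      show "(0 < neg_vec x (top_index m (neg_vec x))) = (\<not> 0 < x (top_index m x))"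
        if "n \<le> m" "t \<in> Poly_Mapping.keys (h' n)" "x \<in> set t" for n t x
      proof -
        have "neg_vec x (top_index m (neg_vec x)) = - x (top_index m x)"
          unfolding top_index_neg_vec by (simp add: neg_vec_def)
        then show ?thesis
          using large [OF that] \<open>\<epsilon> > 0\<close> by linarith
      qed
      show "top_index m (neg_vec x) = top_index m x" for x
        by (rule top_index_neg_vec)
      show "top_index m x < m" for x
        by (rule top_index(1) [OF m])
      show "(0 < x (top_index m x)) = (0 < y (top_index m y))"
        if t: "t \<in> Poly_Mapping.keys (h' m)" and xy: "x \<in> set t" "y \<in> set t"
          and eq: "top_index m x = top_index m y" for t x y
      proof -
        let ?i = "top_index m y"
        have "\<epsilon> \<le> \<bar>x ?i\<bar>" "\<epsilon> \<le> \<bar>y ?i\<bar>"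
          using large [OF order_refl t xy(1)] large [OF order_refl t xy(2)] eq by simp_all
        moreover have "\<bar>x ?i - y ?i\<bar> \<le> \<epsilon>"
          using diam_leD [OF fine [OF order_refl t] xy] .
        ultimately show ?thesis
          unfolding eq using \<open>\<epsilon> > 0\<close> by linarith
      qed
    qed
  qed
qed

section \<open>The discontinuity bound\<close>

text \<open>A bound on the size of the support is not visibly a closed condition, but each of the
  finitely many faces is closed in a compact cube.\<close>

lemma compact_skeleton: "compact (skeleton d N)"
proof -
  define face where "face \<sigma> = {x :: nat \<Rightarrow> real. (\<forall>i. 0 \<le> x i) \<and> (\<forall>i. i \<notin> \<sigma> \<longrightarrow> x i = 0) \<and> (\<Sum>i\<le>N. x i) = 1}" for \<sigma>
  let ?S = "{\<sigma>. \<sigma> \<subseteq> {..N} \<and> card \<sigma> \<le> d + 1}"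
  have "skeleton d N = (\<Union>\<sigma>\<in>?S. face \<sigma>)"
  proof (intro subset_antisym subsetI)
    fix x assume x: "x \<in> skeleton d N"
    have "{i. x i \<noteq> 0} \<in> ?S"
      using x by (auto simp: skeleton_def) (meson not_le)
    moreover have "x \<in> face {i. x i \<noteq> 0}"
      using x by (simp add: skeleton_def face_def)
    ultimately show "x \<in> (\<Union>\<sigma>\<in>?S. face \<sigma>)" by blast
  next
    fix x assume "x \<in> (\<Union>\<sigma>\<in>?S. face \<sigma>)"
    then obtain \<sigma> where \<sigma>: "\<sigma> \<subseteq> {..N}" "card \<sigma> \<le> d + 1" and x: "x \<in> face \<sigma>" by blast
    have "{i. x i \<noteq> 0} \<subseteq> \<sigma>"
      using x by (auto simp: face_def)
    then have "card {i. x i \<noteq> 0} \<le> card \<sigma>"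
      using \<sigma>(1) by (intro card_mono) (auto intro: finite_subset)
    moreover have "\<forall>i>N. x i = 0"
      using x \<sigma>(1) by (force simp: face_def)
    ultimately show "x \<in> skeleton d N"
      using x \<sigma>(2) by (simp add: skeleton_def face_def)
  qed
  moreover have "compact (face \<sigma>)" if "\<sigma> \<subseteq> {..N}" for \<sigma>
  proof -
    have "closed (face \<sigma>)"
      unfolding face_def
      by (intro closed_Collect_conj closed_Collect_all closed_Collect_imp closed_Collect_le closed_Collect_eq
          continuous_on_const continuous_on_sum continuous_on_product_coordinates open_Collect_const)
    moreover have "compact (PiE UNIV (\<lambda>_::nat. {0..1::real}))"
      using compactin_PiE [of "\<lambda>_::nat. euclideanreal" UNIV "\<lambda>_. {0..1}"]
      by (simp add: euclidean_product_topology)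
    moreover have "face \<sigma> \<subseteq> PiE UNIV (\<lambda>_::nat. {0..1::real})"
    proof
      fix x assume x: "x \<in> face \<sigma>"
      have "x i \<le> 1" for i
      proof (cases "i \<le> N")
        case True
        then have "x i \<le> (\<Sum>i\<le>N. x i)"
          using x by (intro member_le_sum) (auto simp: face_def)
        then show ?thesis using x by (simp add: face_def)
      next
        case False
        then have "x i = 0"
          using x that by (force simp: face_def)
        then show ?thesis by simp
      qed
      then show "x \<in> PiE UNIV (\<lambda>_::nat. {0..1::real})"
        using x by (auto simp: face_def)
    qed
    ultimately show ?thesis
      by (metis compact_Int_closed inf.absorb2)
  qed
  moreover have "finite ?S"
    by (rule finite_subset [of _ "Pow {..N}"]) auto
  ultimately show ?thesis
    by (simp only:) (intro compact_UN, auto)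
qed

text \<open>Having disjoint supports is a closed condition, unlike \<open>x \<noteq> y\<close>; the
  compactness gained provides a Lebesgue number in the final proof.\<close>

lemma compact_deleted_product: "compact (deleted_product d N)"
proof -
  have coord: "continuous_on UNIV (\<lambda>p::(nat \<Rightarrow> real) \<times> (nat \<Rightarrow> real). fst p i)"
    "continuous_on UNIV (\<lambda>p::(nat \<Rightarrow> real) \<times> (nat \<Rightarrow> real). snd p i)" for i
    by (rule continuous_on_product_then_coordinatewise, intro continuous_intros)+
  have "closed {p::(nat \<Rightarrow> real) \<times> (nat \<Rightarrow> real). \<forall>i. fst p i * snd p i = 0}"
    by (intro closed_Collect_all closed_Collect_eq continuous_on_mult coord continuous_on_const)
  moreover have "deleted_product d N = skeleton d N \<times> skeleton d N \<inter> {p. \<forall>i. fst p i * snd p i = 0}"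
    by (auto simp: deleted_product_def)
  ultimately show ?thesis
    by (simp add: compact_Times compact_skeleton compact_Int_closed)
qed

abbreviation distinct_pairs :: "'a set \<Rightarrow> ('a \<times> 'a) set" where
  "distinct_pairs S \<equiv> {(x, y). x \<in> S \<and> y \<in> S \<and> x \<noteq> y}"

lemma deleted_product_subset: "deleted_product d N \<subseteq> distinct_pairs (skeleton d N)"
proof clarify
  fix x y assume xy: "(x, y) \<in> deleted_product d N"
  have "x \<noteq> y"
  proof
    assume "x = y"
    then have "x i = 0" for i
      using xy by (auto simp: deleted_product_def)
    then show False
      using xy by (simp add: deleted_product_def skeleton_def)
  qed
  then show "x \<in> skeleton d N \<and> y \<in> skeleton d N \<and> x \<noteq> y"
    using xy by (auto simp: deleted_product_def)
qed

lemma topspace_Conf2_subtopology: "topspace (Conf2 (subtopology euclidean S)) = distinct_pairs S"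
  by (auto simp: Conf2_def)

lemma openin_Conf2_subtopology:
  assumes "openin (Conf2 (subtopology euclidean S)) U" "p \<in> U"
  obtains V where "open V" "p \<in> V" "V \<inter> distinct_pairs S \<subseteq> U"
proof -
  obtain T where "openin (prod_topology (subtopology euclidean S) (subtopology euclidean S)) T"
    and U: "U = T \<inter> distinct_pairs S"
    using assms(1) by (auto simp: Conf2_def openin_subtopology)
  then have "openin (subtopology euclidean (S \<times> S)) T"
    by simp
  then obtain V where "open V" "T = V \<inter> S \<times> S"
    by (auto simp: openin_subtopology)
  then show thesis
    using assms(2) U by (intro that [of V]) auto
qed

text \<open>The metric is at most twice a maximum over finitely many coordinates plus
  \<open>(1 / 2) ^ N\<close>; the coordinate bound \<open>e / 4\<close> and the choice of
  \<open>N\<close> keep the two parts within \<open>e / 2\<close> each.\<close>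

lemma dist_fun_lt:
  assumes "0 < e"
  obtains \<epsilon> where "0 < \<epsilon>" "\<forall>x y :: nat \<Rightarrow> real. (\<forall>i. \<bar>x i - y i\<bar> \<le> \<epsilon>) \<longrightarrow> dist x y < e"
proof -
  obtain N where N: "(1 / 2 :: real) ^ N < e / 2"
    using real_arch_pow_inv [of "e / 2" "1 / 2"] assms by auto
  show thesis
  proof (rule that)
    show "0 < e / 4" using assms by simp
    show "\<forall>x y :: nat \<Rightarrow> real. (\<forall>i. \<bar>x i - y i\<bar> \<le> e / 4) \<longrightarrow> dist x y < e"
    proof (intro allI impI)
      fix x y :: "nat \<Rightarrow> real" assume le: "\<forall>i. \<bar>x i - y i\<bar> \<le> e / 4"
      let ?A = "{dist (x (from_nat n)) (y (from_nat n)) |n. n \<le> N}"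
      have "?A = (\<lambda>n. dist (x (from_nat n)) (y (from_nat n))) ` {..N}"
        by auto
      then have "Max ?A \<le> e / 4"
        by (simp only:, intro Max.boundedI) (use le in \<open>auto simp: dist_real_def\<close>)
      then show "dist x y < e"
        using dist_fun_le_dist_first_terms [of x y N] N by linarith
    qed
  qed
qed

lemma vinner_unit_bounds:
  assumes "vinner m u u = 1" "vinner m v v = 1"
  shows "- 1 \<le> vinner m u v" "vinner m u v \<le> 1"
proof -
  have "(vinner m u v)\<^sup>2 \<le> 1"
    using Cauchy_Schwarz_ineq_sum [of u v "{..<m}"] assms by (simp add: vinner_def power2_eq_square)
  then have "\<bar>vinner m u v\<bar> \<le> 1"
    by (simp add: abs_square_le_1)
  then show "- 1 \<le> vinner m u v" "vinner m u v \<le> 1" by linarith+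
qed

text \<open>Unconditional because division by zero yields the zero vector; \<open>tower_map\<close>
  asks for equivariance at every point, not only on the deleted product.\<close>

lemma Phi_swap: "Phi m f (y, x) = neg_vec (Phi m f (x, y))"
proof -
  have "vnorm m (\<lambda>j. f y j - f x j) = vnorm m (\<lambda>j. f x j - f y j)"
    unfolding vnorm_def vinner_def
    by (intro arg_cong [where f = sqrt] sum.cong) (simp_all add: algebra_simps)
  then show ?thesis
    by (auto simp: Phi_def neg_vec_def minus_divide_left)
qed

lemma Phi_unit:
  assumes "\<forall>x\<in>S. \<forall>i\<ge>m. f x i = 0" "inj_on f S" "p \<in> distinct_pairs S"
  shows "vinner m (Phi m f p) (Phi m f p) = 1"
proof -
  obtain x y where p: "p = (x, y)" and xy: "x \<in> S" "y \<in> S" "x \<noteq> y"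
    using assms(3) by auto
  define D where "D = vinner m (\<lambda>j. f x j - f y j) (\<lambda>j. f x j - f y j)"
  have "f x \<noteq> f y"
    using assms(2) xy by (auto dest: inj_onD)
  then obtain i where "f x i \<noteq> f y i" by blast
  then have "i < m"
    using assms(1) xy by (metis not_le)
  have "D > 0"
    unfolding D_def vinner_def
    by (rule sum_pos2 [of _ i]) (use \<open>i < m\<close> \<open>f x i \<noteq> f y i\<close> in \<open>auto simp: less_le\<close>)
  have "vinner m (Phi m f p) (Phi m f p) = (\<Sum>i<m. (f x i - f y i) * (f x i - f y i) / D)"
    using \<open>D > 0\<close> unfolding vinner_def p
    by (intro sum.cong) (auto simp: Phi_def vnorm_def D_def [symmetric])
  also have "\<dots> = D / D"
    by (simp only: sum_divide_distrib [symmetric] D_def vinner_def)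
  finally show ?thesis
    using \<open>D > 0\<close> by simp
qed

text \<open>The cosine decreases between 0 and pi, so small geodesic diameters become lower bounds
  \<open>s = cos \<delta>\<close> on inner products.\<close>

lemma mod_discont_less_imp_local_inner:
  assumes unit: "\<And>x. x \<in> topspace X \<Longrightarrow> vinner m (g x) (g x) = 1"
    and less: "mod_discont X (geodist m) g < r" and "r \<le> pi"
  obtains s where "cos r < s"
    "\<forall>x\<in>topspace X. \<exists>U. openin X U \<and> x \<in> U \<and> (\<forall>y\<in>U. \<forall>z\<in>U. s \<le> vinner m (g y) (g z))"
proof -
  let ?D = "{\<delta>. \<delta> \<ge> 0 \<and> (\<forall>x\<in>topspace X. \<exists>U. openin X U \<and> x \<in> U \<and> mdiam (geodist m) (g ` U) \<le> \<delta>)}"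
  have bounds: "0 \<le> geodist m (g y) (g z) \<and> geodist m (g y) (g z) \<le> pi \<and>
      cos (geodist m (g y) (g z)) = vinner m (g y) (g z)"
    if "y \<in> topspace X" "z \<in> topspace X" for y z
    unfolding geodist_def using vinner_unit_bounds [of m "g y" "g z"] unit that
    by (simp add: arccos_lbound arccos_ubound)
  \<comment> \<open>The whole space is a neighbourhood of diameter at most pi, so the infimum is
    taken over a nonempty set and some \<delta> below \<open>r\<close> belongs to it.\<close>
  have "mdiam (geodist m) (g ` topspace X) \<le> pi" if "x \<in> topspace X" for x
    unfolding mdiam_def by (rule cSup_least) (use that bounds in auto)
  then have "pi \<in> ?D" by auto
  then obtain \<delta> where \<delta>: "\<delta> \<in> ?D" "\<delta> < r"
    using less cInf_lessD [of ?D r] unfolding mod_discont_def by blast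
  show thesis
  proof (rule that)
    show "cos r < cos \<delta>"
      using \<delta> \<open>r \<le> pi\<close> by (intro cos_monotone_0_pi) auto
    show "\<forall>x\<in>topspace X. \<exists>U. openin X U \<and> x \<in> U \<and> (\<forall>y\<in>U. \<forall>z\<in>U. cos \<delta> \<le> vinner m (g y) (g z))"
    proof
      fix x assume "x \<in> topspace X"
      then obtain U where U: "openin X U" "x \<in> U" "mdiam (geodist m) (g ` U) \<le> \<delta>"
        using \<delta>(1) by blast
      have "cos \<delta> \<le> vinner m (g y) (g z)" if "y \<in> U" "z \<in> U" for y z
      proof -
        have top: "U \<subseteq> topspace X"
          using U(1) by (rule openin_subset)
        then have yz: "y \<in> topspace X" "z \<in> topspace X"
          using that by auto
        \<comment> \<open>A real supremum is known to dominate its members only once the set is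
          bounded above.\<close>
        have "bdd_above {geodist m u v |u v. u \<in> g ` U \<and> v \<in> g ` U}"
          by (rule bdd_aboveI [of _ pi]) (use bounds top in blast)
        then have "geodist m (g y) (g z) \<le> mdiam (geodist m) (g ` U)"
          unfolding mdiam_def by (rule cSup_upper [rotated]) (use that in blast)
        then have "geodist m (g y) (g z) \<le> \<delta>"
          using U(3) by linarith
        then have "cos \<delta> \<le> cos (geodist m (g y) (g z))"
          using bounds [OF yz] \<delta>(2) \<open>r \<le> pi\<close> by (intro cos_monotone_0_pi_le) auto
        then show ?thesis
          using bounds [OF yz] by simp
      qed
      then show "\<exists>U. openin X U \<and> x \<in> U \<and> (\<forall>y\<in>U. \<forall>z\<in>U. cos \<delta> \<le> vinner m (g y) (g z))"
        using U(1,2) by blast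
    qed
  qed
qed

theorem theorem1p3:
  fixes d :: nat and f :: "(nat \<Rightarrow> real) \<Rightarrow> (nat \<Rightarrow> real)"
  assumes "d \<ge> 1"
    and "\<forall>x\<in>skeleton d (2*d+2). \<forall>i\<ge>2*d. f x i = 0"
    and "inj_on f (skeleton d (2*d+2))"
  shows "alpha (skeleton_top d (2*d+2)) (2*d) f \<ge> r_const (2*d - 1)"
proof (rule ccontr)
  let ?m = "2 * d" and ?N = "2 * d + 2"
  let ?S = "skeleton d ?N" and ?r = "r_const (2 * d - 1)"
  let ?X = "Conf2 (skeleton_top d ?N)"
  assume "\<not> ?r \<le> alpha (skeleton_top d ?N) ?m f"
  then have less: "mod_discont ?X (geodist ?m) (Phi ?m f) < ?r"
    by (simp add: alpha_def)
  \<comment> \<open>Since \<open>d \<ge> 1\<close>, the natural subtraction \<open>2 * d - 1\<close>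
    is exact and the denominator becomes \<open>2 * d\<close>.\<close>
  have r: "?r = arccos (- 1 / real ?m)"
    using assms(1) by (simp add: r_const_def of_nat_diff)
  have "- 1 \<le> - 1 / real ?m" "- 1 / real ?m \<le> 1"
    using assms(1) by (simp_all add: field_simps)
  then have r_pi: "?r \<le> pi" and cos_r: "cos ?r = - 1 / real ?m"
    unfolding r by (rule arccos_ubound, rule cos_arccos)
  have top: "topspace ?X = distinct_pairs ?S"
    unfolding skeleton_top_def by (rule topspace_Conf2_subtopology)
  have unit: "vinner ?m (Phi ?m f p) (Phi ?m f p) = 1" if "p \<in> topspace ?X" for p
    using assms(2,3) that [unfolded top] by (rule Phi_unit)
  obtain s where s: "cos ?r < s"
    and local: "\<forall>p\<in>topspace ?X. \<exists>U. openin ?X U \<and> p \<in> U \<and>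
      (\<forall>y\<in>U. \<forall>z\<in>U. s \<le> vinner ?m (Phi ?m f y) (Phi ?m f z))"
    by (rule mod_discont_less_imp_local_inner [OF unit less r_pi])
  define spread where "spread V \<longleftrightarrow> (\<forall>y\<in>V \<inter> distinct_pairs ?S. \<forall>z\<in>V \<inter> distinct_pairs ?S.
    s \<le> vinner ?m (Phi ?m f y) (Phi ?m f z))" for V
  define \<G> where "\<G> = {V. open V \<and> spread V}"
  have cover: "deleted_product d ?N \<subseteq> \<Union>\<G>"
  proof
    fix p assume "p \<in> deleted_product d ?N"
    then have "p \<in> topspace ?X"
      unfolding top using deleted_product_subset by blast
    then obtain U where U: "openin ?X U" "p \<in> U"
      "\<forall>y\<in>U. \<forall>z\<in>U. s \<le> vinner ?m (Phi ?m f y) (Phi ?m f z)"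
      using local by blast
    obtain V where "open V" "p \<in> V" "V \<inter> distinct_pairs ?S \<subseteq> U"
      using U(1,2) unfolding skeleton_top_def by (rule openin_Conf2_subtopology)
    then show "p \<in> \<Union>\<G>"
      using U(3) unfolding \<G>_def spread_def by blast
  qed
  \<comment> \<open>A Lebesgue number of the cover by open sets on which directions are spread at
    most as far as \<open>s\<close> allows.\<close>
  obtain e where "0 < e" and e: "\<And>p. p \<in> deleted_product d ?N \<Longrightarrow> \<exists>V\<in>\<G>. ball p e \<subseteq> V"
    by (rule Heine_Borel_lemma [OF compact_deleted_product cover]) (simp add: \<G>_def, blast)
  \<comment> \<open>Half of \<open>e\<close> for each factor of the product.\<close>
  obtain \<epsilon> where "0 < \<epsilon>"
    and \<epsilon>: "\<forall>x y :: nat \<Rightarrow> real. (\<forall>i. \<bar>x i - y i\<bar> \<le> \<epsilon>) \<longrightarrow> dist x y < e / 2"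
    using half_gt_zero [OF \<open>0 < e\<close>] by (rule dist_fun_lt)
  obtain h where h: "tower ?m swap_pt h"
    and h_props: "\<forall>n\<le>?m. \<forall>t\<in>Poly_Mapping.keys (h n). diam_le t \<epsilon> \<and>
      (\<forall>x\<in>set t. pt_pair x \<in> deleted_product d ?N)"
    by (rule fine_deleted_product_tower [OF \<open>0 < \<epsilon>\<close>])
  have fine: "diam_le t \<epsilon>" if "n \<le> ?m" "t \<in> Poly_Mapping.keys (h n)" for n t
    using h_props that by blast
  have del: "pt_pair x \<in> deleted_product d ?N"
    if "n \<le> ?m" "t \<in> Poly_Mapping.keys (h n)" "x \<in> set t" for n t x
    using h_props that by blast
  define \<phi> where "\<phi> x = Phi ?m f (pt_pair x)" for x
  have inner: "s \<le> vinner ?m (\<phi> x) (\<phi> y)"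
    if n: "n \<le> ?m" and t: "t \<in> Poly_Mapping.keys (h n)" and x: "x \<in> set t" and y: "y \<in> set t" for n t x y
  proof -
    have "dist (fst (pt_pair x)) (fst (pt_pair y)) < e / 2" "dist (snd (pt_pair x)) (snd (pt_pair y)) < e / 2"
      using \<epsilon> diam_leD [OF fine [OF n t] x y] by (simp_all add: pt_pair_def)
    then have "dist (pt_pair x) (pt_pair y) < e"
      using sqrt_sum_squares_le_sum [of "dist (fst (pt_pair x)) (fst (pt_pair y))"
          "dist (snd (pt_pair x)) (snd (pt_pair y))"]
      by (simp add: dist_prod_def)
    moreover obtain V where V: "V \<in> \<G>" "ball (pt_pair x) e \<subseteq> V"
      using e del [OF n t x] by blast
    ultimately have "pt_pair x \<in> V" "pt_pair y \<in> V"
      using \<open>0 < e\<close> by auto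
    then have xV: "pt_pair x \<in> V \<inter> distinct_pairs ?S" and yV: "pt_pair y \<in> V \<inter> distinct_pairs ?S"
      using subsetD [OF deleted_product_subset del [OF n t x]] subsetD [OF deleted_product_subset del [OF n t y]]
      by (simp_all only: Int_iff simp_thms)
    have "spread V"
      using V(1) by (simp add: \<G>_def)
    from bspec [OF bspec [OF this [unfolded spread_def] xV] yV]
    show ?thesis unfolding \<phi>_def .
  qed
  show False
  proof (rule no_spread_tower)
    show "0 < ?m" using assms(1) by simp
    show "- 1 / real ?m < s" using s cos_r by simp
    \<comment> \<open>Swapping the signs swaps the two points of the pair, which reverses the
      direction between their images.\<close>
    have "\<phi> (swap_pt x) = neg_vec (\<phi> x)" for x
      by (simp add: \<phi>_def pt_pair_def swap_pt_def flip_def Phi_swap [of _ _ "\<lambda>i. x (False, i)"])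
    with h show "tower ?m neg_vec (\<lambda>n. chmap (map \<phi>) (h n))"
      by (rule tower_map [where \<phi> = \<phi> and \<mu> = neg_vec])
    show "vinner ?m v v = 1 \<and> (\<forall>i\<ge>?m. v i = 0)"
      if n: "n \<le> ?m" and t: "t \<in> Poly_Mapping.keys (chmap (map \<phi>) (h n))" and v: "v \<in> set t" for n t v
    proof -
      obtain t' where t': "t' \<in> Poly_Mapping.keys (h n)" "t = map \<phi> t'"
        using keys_linD [OF t] by auto
      then obtain x where x: "x \<in> set t'" "v = \<phi> x"
        using v by auto
      have "pt_pair x \<in> topspace ?X"
        unfolding top by (rule subsetD [OF deleted_product_subset del [OF n t'(1) x(1)]])
      then show ?thesis
        using unit [of "pt_pair x"] by (simp add: x(2) \<phi>_def Phi_def split: prod.splits)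
    qed
    show "s \<le> vinner ?m v w"
      if n: "n \<le> ?m" and t: "t \<in> Poly_Mapping.keys (chmap (map \<phi>) (h n))" and vw: "v \<in> set t" "w \<in> set t" for n t v w
    proof -
      obtain t' where "t' \<in> Poly_Mapping.keys (h n)" "t = map \<phi> t'"
        using keys_linD [OF t] by auto
      then show ?thesis
        using inner [OF n] vw by auto
    qed
  qed
qed

end
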